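(* Let $K$ be a field, let $H \in K[x]^m$ be a quadratic homogeneous polynomial map in the variables $x=(x_1,\ldots,x_n)$, and let $r := \operatorname{rk} \mathcal{J}H$. Then there are $S \in \operatorname{GL}_m(K)$ and $T \in \operatorname{GL}_n(K)$ such that for $\tilde{H} := S H(Tx)$, only the first $\frac12 r^2 + \frac12 r$ rows of $\mathcal{J}\tilde{H}$ may be nonzero, and one of the following statements holds: (1) only the first $\frac12 r^2 - \frac12 r + 1$ rows of $\mathcal{J}\tilde{H}$ may be nonzero; (2) $\operatorname{char} K \neq 2$ and only the first $r$ columns of $\mathcal{J}\tilde{H}$ are nonzero; (3) $\operatorname{char} K = 2$ and only the first $r+1$ columns of $\mathcal{J}\tilde{H}$ are nonzero. Conversely, for a nonnegative integer $r$ and a quadratic homogeneous polynomial map $\tilde{H} \in K[x]^m$, one has $\operatorname{rk}\mathcal{J}\tilde{H} \le r$ if either $\tilde{H}$ is as in (2) or (3), or $1 \le r \le 2$ and $\tilde{H}$ is as in (1).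
   Context: $K$ is a field of arbitrary characteristic and $K[x]=K[x_1,\ldots,x_n]$. A polynomial map $H=(H_1,\ldots,H_m)\in K[x]^m$ is quadratic homogeneous if each $H_i$ is zero or homogeneous of degree $2$. $\mathcal{J}H=(\partial H_i/\partial x_j)$ is the $m\times n$ Jacobian matrix, and its rank is taken over $K(x)$. $SH(Tx)$ denotes the map obtained by substituting $Tx$ for $x$ in $H$ and then applying $S$. "Only the first $k$ rows may be nonzero" (resp. "only the first $k$ columns are nonzero") means that every row (resp. column) with index $>k$ is zero. *)

theory Defs
  imports
    "HOL-Library.Poly_Mapping"
    "HOL-Computational_Algebra.Fraction_Field"
    "Jordan_Normal_Form.DL_Rank"
begin

text \<open>
  Polynomials over \<open>'k\<close> in countably many indeterminates \<open>x\<^sub>0, x\<^sub>1, \<dots>\<close>: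
  finitely supported maps from exponent vectors to coefficients, with the convolution product of
  \<^theory>\<open>HOL-Library.Poly_Mapping\<close>. The ring \<open>K[x\<^sub>1, \<dots>, x\<^sub>n]\<close> is the subring
  \<open>polys_in n\<close>; all indices (of indeterminates, rows and columns) start at 0.
\<close>

type_synonym 'k mpoly = "(nat \<Rightarrow>\<^sub>0 nat) \<Rightarrow>\<^sub>0 'k"

definition Const :: "'k::zero \<Rightarrow> 'k mpoly" where
  "Const c = Poly_Mapping.single 0 c"

definition Var :: "nat \<Rightarrow> 'k::zero_neq_one mpoly" where
  "Var i = Poly_Mapping.single (Poly_Mapping.single i 1) 1"

definition polys_in :: "nat \<Rightarrow> 'k::zero mpoly set" where
  "polys_in n = {p. \<forall>t \<in> Poly_Mapping.keys p. Poly_Mapping.keys t \<subseteq> {..<n}}"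

definition mon_degree :: "(nat \<Rightarrow>\<^sub>0 nat) \<Rightarrow> nat" where
  "mon_degree t = (\<Sum>i \<in> Poly_Mapping.keys t. Poly_Mapping.lookup t i)"

text \<open>The zero polynomial counts as homogeneous of every degree.\<close>

definition homogeneous :: "nat \<Rightarrow> 'k::zero mpoly \<Rightarrow> bool" where
  "homogeneous d p \<longleftrightarrow> (\<forall>t \<in> Poly_Mapping.keys p. mon_degree t = d)"

definition quadratic_homogeneous :: "nat \<Rightarrow> nat \<Rightarrow> 'k::zero mpoly vec \<Rightarrow> bool" where
  "quadratic_homogeneous m n H \<longleftrightarrow> H \<in> carrier_vec m \<and>
     (\<forall>i < m. H $ i \<in> polys_in n \<and> homogeneous 2 (H $ i))"

text \<open>
  The formal partial derivative. Subtraction of exponents truncates, but only in terms whose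
  coefficient \<open>of_nat (lookup t j)\<close> is zero.
\<close>

definition pderiv_var :: "nat \<Rightarrow> 'k::comm_semiring_1 mpoly \<Rightarrow> 'k mpoly" where
  "pderiv_var j p = (\<Sum>t \<in> Poly_Mapping.keys p.
     Poly_Mapping.single (t - Poly_Mapping.single j 1)
       (of_nat (Poly_Mapping.lookup t j) * Poly_Mapping.lookup p t))"

definition jacobian :: "nat \<Rightarrow> 'k::comm_semiring_1 mpoly vec \<Rightarrow> 'k mpoly mat" where
  "jacobian n H = mat (dim_vec H) n (\<lambda>(i, j). pderiv_var j (H $ i))"

text \<open>
  The rank over the field of fractions. For a matrix with entries in \<open>K[x\<^sub>1, \<dots>, x\<^sub>n]\<close> this field is
  an extension of \<open>K(x\<^sub>1, \<dots>, x\<^sub>n)\<close>, which does not affect the rank.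
\<close>

definition fract_rank :: "'k::field mpoly mat \<Rightarrow> nat" where
  "fract_rank A = vec_space.rank (dim_row A) (map_mat (\<lambda>p. Fract p 1) A)"

text \<open>Substitution of the polynomials \<open>f 0, f 1, \<dots>\<close> for the indeterminates.\<close>

definition subst_poly :: "(nat \<Rightarrow> 'k mpoly) \<Rightarrow> 'k::comm_semiring_1 mpoly \<Rightarrow> 'k mpoly" where
  "subst_poly f p = (\<Sum>t \<in> Poly_Mapping.keys p.
     Const (Poly_Mapping.lookup p t) * (\<Prod>i \<in> Poly_Mapping.keys t. f i ^ Poly_Mapping.lookup t i))"

definition GL :: "nat \<Rightarrow> 'k::semiring_1 mat set" where
  "GL n = {A \<in> carrier_mat n n. invertible_mat A}"

text \<open>
  The map \<open>S H(T x)\<close>, where \<open>x = (x\<^sub>0, \<dots>, x\<^bsub>n-1\<^esub>)\<close> and \<open>n\<close> is the number of columns of \<open>T\<close>.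
\<close>

definition linear_transform ::
  "'k::comm_semiring_1 mat \<Rightarrow> 'k mat \<Rightarrow> 'k mpoly vec \<Rightarrow> 'k mpoly vec" where
  "linear_transform S T H =
     (let Tx = map_mat Const T *\<^sub>v vec (dim_col T) Var
      in map_mat Const S *\<^sub>v map_vec (subst_poly (\<lambda>j. Tx $ j)) H)"

definition only_first_rows :: "nat \<Rightarrow> 'a::zero mat \<Rightarrow> bool" where
  "only_first_rows k A \<longleftrightarrow> (\<forall>i < dim_row A. k \<le> i \<longrightarrow> row A i = 0\<^sub>v (dim_col A))"

definition only_first_cols :: "nat \<Rightarrow> 'a::zero mat \<Rightarrow> bool" where
  "only_first_cols k A \<longleftrightarrow> (\<forall>j < dim_col A. k \<le> j \<longrightarrow> col A j = 0\<^sub>v (dim_row A))"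

text \<open>
  The three alternatives for the shape of the Jacobian. As \<open>r\<^sup>2\<close> and \<open>r\<close> have the same
  parity and \<open>r \<le> r\<^sup>2\<close>, neither the division nor the subtraction truncates.
\<close>

definition few_rows :: "nat \<Rightarrow> nat \<Rightarrow> 'k::field mpoly vec \<Rightarrow> bool" where
  "few_rows n r H \<longleftrightarrow> only_first_rows ((r\<^sup>2 - r) div 2 + 1) (jacobian n H)"

definition few_cols_char_not_2 :: "nat \<Rightarrow> nat \<Rightarrow> 'k::field mpoly vec \<Rightarrow> bool" where
  "few_cols_char_not_2 n r H \<longleftrightarrow> CHAR('k) \<noteq> 2 \<and> only_first_cols r (jacobian n H)"

definition few_cols_char_2 :: "nat \<Rightarrow> nat \<Rightarrow> 'k::field mpoly vec \<Rightarrow> bool" where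
  "few_cols_char_2 n r H \<longleftrightarrow> CHAR('k) = 2 \<and> only_first_cols (r + 1) (jacobian n H)"

end

(*
  Let M = JH, viewed over L = K(x), let B be the polarization of H, so that M y = B(x, y) at the
  generic point x, and let U be the column space of M, of dimension r. If w is a polynomial vector
  with M w = 0, then expanding M w = 0 at x + t y gives vectors w1, w2, ... with
    M w1 = - B(y, w),   M w2 = - B(y, w1),   M w3 = - B(y, w2).
  Consequently B(y, w) lies in U for w in ker M, i.e. modulo U the form B lives on a space of
  dimension at most r, and if M z = B(y, w) then B(y, z) lies in U. The values of B are therefore
  spanned by U together with values on a basis of a complement of the radical R of B mod U, where R
  contains ker M and x. Either the second relation removes one more basis vector, and alternative
  (1) holds, or B(y, w) is so degenerate for w in ker M that the vectors on which B vanishes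
  identically have small codimension. Finally, the dimensions of the value space and of the radical
  of B do not change under the field extension from K to L.
*)
theory Submission
  imports Defs "HOL-Library.Function_Algebras"
begin

section \<open>Symmetric forms at a generic point\<close>

text \<open>All bounds come from one count. Let d be the dimension of the image of R under M. A
  complement of R has e = r - d basis vectors, so the values of B are spanned by r + e(e + 1)/2
  vectors, and by r + e(e - 1)/2 in characteristic 2, where B is alternating. In characteristic 2
  one starts with d = 0. In other characteristics M x \<noteq> 0 gives d \<ge> 1, since M x = 0
  would make R the whole space and leave no values outside U. Either way the start gives r(r + 1)/2,
  and one unit more in d, or one basis vector less, gives r(r - 1)/2 + 1. In the remaining case R
  lies in the sum of the radical of B and the line through x, so this radical has codimension at
  most r - d + 1, which is r + 1 or r. S and T must have entries in K, whereas all bases above live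
  over L. Echelon reduction over K produces S and T unless too many independent vectors over K stand
  in the way; these would come with a dual family, so they would stay independent over L.\<close>

lemma card_image_symmetric:
  assumes "finite E" and sym: "\<And>a b. f a b = f b a"
  shows "finite {f a b |a b. a \<in> E \<and> b \<in> E} \<and>
    2 * card {f a b |a b. a \<in> E \<and> b \<in> E} \<le> card E * (card E + 1)"
  using assms(1)
proof induction
  case (insert x E)
  let ?S = "{f a b |a b. a \<in> E \<and> b \<in> E}"
  have eq: "{f a b |a b. a \<in> insert x E \<and> b \<in> insert x E} = ?S \<union> f x ` insert x E"
    using sym by blast
  have "card (?S \<union> f x ` insert x E) \<le> card ?S + card (f x ` insert x E)"
    by (rule card_Un_le)
  moreover have "card (f x ` insert x E) \<le> card E + 1"
    using card_image_le[of "insert x E" "f x"] insert by simp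
  ultimately show ?case
    unfolding eq using insert by (auto simp: algebra_simps)
qed simp

lemma card_image_alternating:
  assumes "finite E" and sym: "\<And>a b. f a b = f b a"
  shows "finite {f a b |a b. a \<in> E \<and> b \<in> E \<and> a \<noteq> b} \<and>
    2 * card {f a b |a b. a \<in> E \<and> b \<in> E \<and> a \<noteq> b} \<le> card E * (card E - 1)"
  using assms(1)
proof induction
  case (insert x E)
  let ?S = "{f a b |a b. a \<in> E \<and> b \<in> E \<and> a \<noteq> b}"
  have eq: "{f a b |a b. a \<in> insert x E \<and> b \<in> insert x E \<and> a \<noteq> b} = ?S \<union> f x ` E"
    using sym insert(2) by blast
  have "card (?S \<union> f x ` E) \<le> card ?S + card (f x ` E)"
    by (rule card_Un_le)
  moreover have "card (f x ` E) \<le> card E"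
    using card_image_le[of E "f x"] insert by simp
  ultimately have "2 * card (?S \<union> f x ` E) \<le> card E * (card E - 1) + 2 * card E"
    using insert by auto
  also have "\<dots> = card (insert x E) * (card (insert x E) - 1)"
    using insert by (cases "card E") auto
  finally show ?case
    unfolding eq using insert by auto
qed simp

text \<open>Genericity of \<open>v\<close> enters only through \<open>chain\<close>:
  \<open>w1\<close>, \<open>w2\<close>, \<open>w3\<close> are the next coefficients of a kernel
  vector expanded at v + t y. Two of them drive \<open>second_order\<close>, the third serves
  \<open>third_order\<close>. Finiteness is asked only of the values at \<open>v\<close>.\<close>

locale generic_symmetric_form = vector_space_pair s1 s2
  for s1 :: "'a::field \<Rightarrow> 'b::ab_group_add \<Rightarrow> 'b" (infixr \<open>*a\<close> 75)
    and s2 :: "'a \<Rightarrow> 'c::ab_group_add \<Rightarrow> 'c" (infixr \<open>*b\<close> 75) +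
  fixes B :: "'b \<Rightarrow> 'b \<Rightarrow> 'c" and v :: 'b
  assumes B_linear: "Vector_Spaces.linear s1 s2 (B x)"
    and B_sym: "B x y = B y x"
    and B_alt: "(2::'a) = 0 \<Longrightarrow> B x x = 0"
    and chain: "B v w = 0 \<Longrightarrow>
      \<exists>w1 w2 w3. B v w1 = - B y w \<and> B v w2 = - B y w1 \<and> B v w3 = - B y w2"
    and finite_rank: "\<exists>F. finite F \<and> range (B v) \<subseteq> vs2.span F"
begin

section \<open>The value space at the generic point and the radicals of the form\<close>

abbreviation U where "U \<equiv> range (B v)"

definition R where "R = {z. \<forall>y. B y z \<in> U}"

definition rad where "rad = {z. \<forall>y. B y z = 0}"

lemma add_right: "B x (y + z) = B x y + B x z"
  and scale_right: "B x (c *a y) = c *b B x y"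
  and zero_right [simp]: "B x 0 = 0"
  and diff_right: "B x (y - z) = B x y - B x z"
  using linear_add[OF B_linear] linear_scale[OF B_linear] linear_0[OF B_linear]
    linear_diff[OF B_linear] by auto

lemma add_left: "B (y + z) x = B y x + B z x"
  and scale_left: "B (c *a y) x = c *b B y x"
  and diff_left: "B (y - z) x = B y x - B z x"
  by (metis B_sym add_right, metis B_sym scale_right, metis B_sym diff_right)

lemma subspace_U: "vs2.subspace U"
  using linear_subspace_image[OF B_linear vs1.subspace_UNIV] .

lemmas U_add = vs2.subspace_add[OF subspace_U] and U_diff = vs2.subspace_diff[OF subspace_U]
  and U_neg = vs2.subspace_neg[OF subspace_U] and U_scale = vs2.subspace_scale[OF subspace_U]
  and U_0 = vs2.subspace_0[OF subspace_U]

lemma U_minus_iff: "- u \<in> U \<longleftrightarrow> u \<in> U"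
  using U_neg[of u] U_neg[of "- u"] by auto

lemma U_scale_iff: "c \<noteq> 0 \<Longrightarrow> c *b u \<in> U \<longleftrightarrow> u \<in> U"
  using U_scale[of "c *b u" "inverse c"] U_scale[of u c] by auto

lemma subspace_R: "vs1.subspace R"
  unfolding vs1.subspace_def R_def
  by (auto simp: add_right scale_right simp del: rangeI intro!: U_0 U_add U_scale)

lemmas R_add = vs1.subspace_add[OF subspace_R] and R_diff = vs1.subspace_diff[OF subspace_R]

lemma subspace_rad: "vs1.subspace rad"
  unfolding vs1.subspace_def rad_def by (auto simp: add_right scale_right)

lemma R_D: "z \<in> R \<Longrightarrow> B y z \<in> U" "z \<in> R \<Longrightarrow> B z y \<in> U"
  using B_sym by (auto simp: R_def simp del: rangeI)

lemma U_I: "B v x \<in> U" by simp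

lemma v_in_R: "v \<in> R"
proof -
  have "B y v \<in> U" for y unfolding B_sym[of y v] by (rule rangeI)
  then show ?thesis by (simp add: R_def)
qed

lemma kernel_in_R: assumes "B v w = 0" shows "w \<in> R"
  unfolding R_def
proof safe
  fix y
  from chain[OF assms, of y] obtain w1 where "B v w1 = - B y w" by blast
  then have "- B y w \<in> U" by (metis rangeI)
  then show "B y w \<in> U" by (simp only: U_minus_iff)
qed

text \<open>Both \<open>z\<close> and \<open>- w1\<close> are preimages of \<open>B y w\<close>
  under \<open>B v\<close>, so \<open>z + w1\<close> is in the kernel and hence in \<open>R\<close>.
  As \<open>B y w1 = - B v w2\<close> lies in \<open>U\<close>, so does
  \<open>B y z\<close>.\<close>

lemma second_order:
  assumes w: "B v w = 0" and z: "B v z = B y w"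
  shows "B y z \<in> U"
proof -
  from chain[OF w, of y] obtain w1 w2 where c: "B v w1 = - B y w" "B v w2 = - B y w1" by blast
  have "B v (z + w1) = 0" by (simp add: add_right z c)
  from R_D(1)[OF kernel_in_R[OF this], of y]
  have "B y z - B v w2 \<in> U" by (simp add: add_right c)
  from U_add[OF this U_I[of w2]] show ?thesis by simp
qed

text \<open>Lifts add up, so \<open>second_order\<close> holds at \<open>x + y\<close> with the lift
  \<open>z + z'\<close>; its instances at \<open>x\<close> and at \<open>y\<close> are
  subtracted.\<close>

lemma second_order_polarized:
  assumes w: "B v w = 0" and z: "B v z = B x w" "B v z' = B y w"
  shows "B y z + B x z' \<in> U"
proof -
  have "B (x + y) (z + z') \<in> U"
    by (rule second_order[OF w]) (simp add: add_left add_right z)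
  then have "B (x + y) (z + z') - (B x z + B y z') \<in> U"
    by (intro U_diff U_add second_order[OF w z(1)] second_order[OF w z(2)])
  moreover have "B (x + y) (z + z') - (B x z + B y z') = B y z + B x z'"
    by (simp add: add_left add_right)
  ultimately show ?thesis by metis
qed

lemma exists_lift: assumes "B v w = 0" shows "\<exists>z. B v z = B x w"
proof -
  have "B x w \<in> U" by (rule R_D(1)[OF kernel_in_R[OF assms]])
  then show ?thesis by auto
qed

lemma equal_mod_kernel: "B v y = B v y' \<Longrightarrow> y' \<in> R \<Longrightarrow> y \<in> R"
  using R_add[OF kernel_in_R[of "y - y'"], of y'] by (simp add: diff_right)

section \<open>Bases adapted to R\<close>

lemma values_in_span:
  assumes E: "vs1.span (E \<union> R) = UNIV" and S: "vs2.subspace S" "U \<subseteq> S"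
    and EE: "\<And>a b. a \<in> E \<Longrightarrow> b \<in> E \<Longrightarrow> B a b \<in> S"
  shows "B x y \<in> S"
proof -
  have sub: "vs1.subspace {y. B x y \<in> S}" for x
    by (rule linear_subspace_linear_preimage[OF B_linear S(1)])
  have "vs1.span (E \<union> R) \<subseteq> {y. B a y \<in> S}" if "a \<in> E" for a
    using EE[OF that] R_D(1) S(2) by (intro vs1.span_minimal sub) auto
  then have *: "B y a \<in> S" if "a \<in> E" for a y
    using that E B_sym[of y a] by auto
  have "vs1.span (E \<union> R) \<subseteq> {y. B x y \<in> S}"
    using * R_D(1) S(2) by (intro vs1.span_minimal sub) auto
  then show ?thesis using E by auto
qed

definition r where "r = vs2.dim U"

lemma basis_U:
  assumes "vs2.independent D" "D \<subseteq> U"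
  obtains Bs where "D \<subseteq> Bs" "vs2.independent Bs" "vs2.span Bs = U" "finite Bs" "card Bs = r"
proof -
  obtain Bs where Bs: "D \<subseteq> Bs" "Bs \<subseteq> U" "vs2.independent Bs" "U \<subseteq> vs2.span Bs"
    using vs2.maximal_independent_subset_extend[OF assms(2,1)] by blast
  obtain F where F: "finite F" "U \<subseteq> vs2.span F" using finite_rank by blast
  have "finite Bs"
    using vs2.independent_span_bound[OF F(1) Bs(3) order_trans[OF Bs(2) F(2)]] ..
  moreover have "vs2.span Bs = U" by (rule vs2.span_subspace[OF Bs(2,4) subspace_U])
  moreover have "card Bs = r" unfolding r_def by (rule vs2.basis_card_eq_dim[OF Bs(2,4,3)])
  ultimately show ?thesis by (intro that[OF Bs(1,3)])
qed

text \<open>Since the kernel of \<open>B v\<close> lies in \<open>R\<close>, preimages of those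
  basis vectors of \<open>U\<close> that are not in \<open>D\<close> span the whole space together
  with \<open>R\<close>. The set \<open>P\<close> prescribes some of these preimages.\<close>

lemma adapted_basis:
  assumes D: "vs2.independent D" "vs2.span D = B v ` R"
    and P: "vs2.independent (D \<union> B v ` P)" "inj_on (B v) P" "D \<inter> B v ` P = {}"
  obtains E where "P \<subseteq> E" "finite E" "card E = r - card D" "vs1.span (E \<union> R) = UNIV"
    and "card D \<le> r"
proof -
  have DU: "D \<subseteq> U" using vs2.span_superset[of D] unfolding D by auto
  obtain Bs where Bs: "D \<union> B v ` P \<subseteq> Bs" "vs2.independent Bs" "vs2.span Bs = U" "finite Bs" "card Bs = r"
    by (rule basis_U[OF P(1)]) (use DU in auto)
  \<comment> \<open>Values coming from \<open>P\<close> are lifted back into \<open>P\<close>, which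
    forces P \<subseteq> E.\<close>
  define pre where "pre u = (if u \<in> B v ` P then inv_into P (B v) u else inv_into UNIV (B v) u)" for u
  have pre: "B v (pre u) = u" if "u \<in> Bs" for u
    using that Bs(3) vs2.span_superset[of Bs]
    by (auto simp: pre_def f_inv_into_f)
  define E where "E = pre ` (Bs - D)"
  have "card E = card (Bs - D)"
    unfolding E_def by (rule card_image) (metis DiffD1 inj_onI pre)
  also have "\<dots> = r - card D"
    using Bs card_Diff_subset[of D Bs] finite_subset[of D Bs] by auto
  finally have card: "card E = r - card D" .
  have cD: "card D \<le> r" using Bs card_mono[of Bs D] by auto
  have PE: "P \<subseteq> E"
  proof
    fix x assume x: "x \<in> P"
    then have "pre (B v x) = x" using P(2) by (simp add: pre_def)
    moreover have "B v x \<in> Bs - D" using x P(3) Bs(1) by auto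
    ultimately show "x \<in> E" unfolding E_def by (metis imageI)
  qed
  have img: "B v ` vs1.span (E \<union> R) = U"
  proof
    have "Bs \<subseteq> B v ` (E \<union> R)"
      using pre D(2) vs2.span_superset[of D] by (auto simp: E_def image_Un image_image)
    then have "vs2.span Bs \<subseteq> vs2.span (B v ` (E \<union> R))" by (rule vs2.span_mono)
    then show "U \<subseteq> B v ` vs1.span (E \<union> R)"
      unfolding linear_span_image[OF B_linear] Bs(3) .
  qed auto
  have "y \<in> vs1.span (E \<union> R)" for y
  proof -
    obtain y' where y': "y' \<in> vs1.span (E \<union> R)" "B v y = B v y'"
      using img by (metis U_I imageE)
    have "y - y' \<in> R" by (rule kernel_in_R) (simp add: diff_right y')
    then have "y - y' \<in> vs1.span (E \<union> R)" by (simp add: vs1.span_base)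
    from vs1.span_add[OF this y'(1)] show ?thesis by simp
  qed
  then have "vs1.span (E \<union> R) = UNIV" by auto
  with PE card cD Bs(4) show ?thesis by (intro that) (auto simp: E_def)
qed

text \<open>The number of unordered pairs of basis vectors; \<open>B\<close> is alternating in characteristic 2.\<close>

definition pairs :: "nat \<Rightarrow> nat" where
  "pairs e = (if (2::'a) = 0 then e * (e - 1) div 2 else e * (e + 1) div 2)"

section \<open>Counting the values of the form\<close>

definition rows_le :: "nat \<Rightarrow> bool" where
  "rows_le N \<longleftrightarrow> (\<exists>F. finite F \<and> card F \<le> N \<and> (\<forall>x y. B x y \<in> vs2.span F))"

lemma rows_le_mono: "rows_le M \<Longrightarrow> M \<le> N \<Longrightarrow> rows_le N"
  unfolding rows_le_def using order_trans by blast

text \<open>The hypothesis quantifies over subspaces \<open>S\<close> containing \<open>U\<close>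
  instead of asking that \<open>E\<close> and \<open>R\<close> span, so that it also covers a set
  \<open>E\<close> from which a vector has been dropped.\<close>

lemma rows_leI:
  assumes E: "finite E"
    and S: "\<And>S x y. vs2.subspace S \<Longrightarrow> U \<subseteq> S \<Longrightarrow> (\<And>a b. a \<in> E \<Longrightarrow> b \<in> E \<Longrightarrow> B a b \<in> S) \<Longrightarrow> B x y \<in> S"
  shows "rows_le (r + pairs (card E))"
proof -
  obtain Bs where Bs: "vs2.span Bs = U" "finite Bs" "card Bs = r"
    by (rule basis_U[of "{}"]) (auto simp: vs2.independent_empty)
  define X where "X = (if (2::'a) = 0 then {B a b |a b. a \<in> E \<and> b \<in> E \<and> a \<noteq> b} else {B a b |a b. a \<in> E \<and> b \<in> E})"
  have X: "finite X" "card X \<le> pairs (card E)"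
    using card_image_symmetric[OF E, of B] card_image_alternating[OF E, of B] B_sym
    by (auto simp: X_def pairs_def)
  have "B x y \<in> vs2.span (Bs \<union> X)" for x y
  proof (rule S)
    show "U \<subseteq> vs2.span (Bs \<union> X)" using Bs vs2.span_mono[of Bs "Bs \<union> X"] by auto
    fix a b assume ab: "a \<in> E" "b \<in> E"
    show "B a b \<in> vs2.span (Bs \<union> X)"
    proof (cases "(2::'a) = 0 \<and> a = b")
      case True
      then show ?thesis using B_alt vs2.span_zero by simp
    next
      case False
      then have "B a b \<in> X" using ab by (auto simp: X_def)
      then show ?thesis by (simp add: vs2.span_base)
    qed
  qed simp
  moreover have "card (Bs \<union> X) \<le> r + pairs (card E)"
    using card_Un_le[of Bs X] X Bs by linarith
  ultimately show ?thesis unfolding rows_le_def using Bs X by blast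
qed

lemma rows_le_codim:
  assumes D: "vs2.independent D" "vs2.span D = B v ` R"
  shows "rows_le (r + pairs (r - card D))" "card D \<le> r"
proof -
  obtain E where E: "finite E" "card E = r - card D" "vs1.span (E \<union> R) = UNIV" "card D \<le> r"
    by (rule adapted_basis[OF D, of "{}"]) (use D in auto)
  show "rows_le (r + pairs (r - card D))"
    unfolding E(2)[symmetric] by (rule rows_leI[OF E(1)]) (rule values_in_span[OF E(3)])
  show "card D \<le> r" by fact
qed

text \<open>
  The relations \<open>B x z \<in> U\<close> and \<open>B b z + B x z\<^sub>b \<in> U\<close> express the values of \<open>B\<close> at \<open>z\<close> by
  other values, so that \<open>z\<close> may be dropped from a basis of a complement of \<open>R\<close>.
\<close>

lemma rows_le_reduced:
  assumes D: "vs2.independent D" "vs2.span D = B v ` R"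
    and w: "B v w = 0" and z: "B v z = B x w" and nz: "\<And>c. z - c *a x \<notin> R"
  shows "rows_le (r + pairs (r - card D - 1))" "card D + 2 \<le> r"
proof -
  have zR: "z \<notin> R" using nz[of 0] by simp
  \<comment> \<open>If \<open>x\<close> were in \<open>R\<close>, the polarized relation would put
    every \<open>B y z\<close> into \<open>U\<close>, hence \<open>z\<close> into
    \<open>R\<close>.\<close>
  have xR: "x \<notin> R"
  proof
    assume x: "x \<in> R"
    have "B y z \<in> U" for y
    proof -
      obtain z' where z': "B v z' = B y w" using exists_lift[OF w] by blast
      have "B y z + B x z' - B x z' \<in> U"
        by (intro U_diff second_order_polarized[OF w z z'] R_D(2) x)
      then show ?thesis by simp
    qed
    then have "z \<in> R" by (simp add: R_def)
    with zR show False by contradiction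
  qed
  \<comment> \<open>Independence of \<open>x\<close> and \<open>z\<close> modulo \<open>R\<close>
    becomes independence of their images modulo \<open>D\<close>, so both may be placed in the basis
    \<open>E\<close>.\<close>
  have Mx: "B v x \<notin> vs2.span D"
    unfolding D using xR equal_mod_kernel by (metis imageE)
  have Mz: "B v z \<notin> vs2.span (insert (B v x) D)"
  proof
    assume "B v z \<in> vs2.span (insert (B v x) D)"
    then obtain k where "B v z - k *b B v x \<in> vs2.span D" unfolding vs2.span_insert by auto
    then obtain y where y: "y \<in> R" "B v z - k *b B v x = B v y" unfolding D by auto
    then have "z - k *a x \<in> R"
      by (intro equal_mod_kernel[OF _ y(1)]) (simp add: diff_right scale_right)
    with nz show False by simp
  qed
  have ne: "B v x \<noteq> B v z" using Mz vs2.span_base[of "B v x" "insert (B v x) D"] by auto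
  have "vs2.independent (insert (B v z) (insert (B v x) D))"
    by (intro vs2.independent_insertI Mx Mz D(1))
  moreover have "D \<union> B v ` {x, z} = insert (B v z) (insert (B v x) D)" by auto
  ultimately have ind: "vs2.independent (D \<union> B v ` {x, z})" by simp
  have "B v x \<notin> D" "B v z \<notin> D"
    using Mx Mz vs2.span_base[of _ D] vs2.span_base[of _ "insert (B v x) D"] by auto
  then obtain E where E: "{x, z} \<subseteq> E" "finite E" "card E = r - card D" "vs1.span (E \<union> R) = UNIV" "card D \<le> r"
    by (elim adapted_basis[OF D ind, rotated 2]) (use ne in auto)
  have xz: "x \<noteq> z" using ne by auto
  have "card {x, z} \<le> card E" by (rule card_mono) (use E in auto)
  then show "card D + 2 \<le> r" using xz E(3) by simp
  \<comment> \<open>The order matters: \<open>B x z\<close> lies in \<open>U\<close>, so all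
    \<open>B x y\<close> are available, in particular the \<open>B x z'\<close> that replace
    \<open>B b z\<close>.\<close>
  have dropped: "B p q \<in> S" if S: "vs2.subspace S" "U \<subseteq> S"
    and EE: "\<And>a b. a \<in> E - {z} \<Longrightarrow> b \<in> E - {z} \<Longrightarrow> B a b \<in> S" for S p q
  proof (rule values_in_span[OF E(4) S])
    have "B x z \<in> S" using second_order[OF w z] S(2) by blast
    then have "B x y \<in> S" if "y \<in> E" for y using EE[of x y] E(1) xz that by (cases "y = z") auto
    then have "vs1.span (E \<union> R) \<subseteq> {y. B x y \<in> S}"
      using subsetD[OF S(2) R_D(1)]
      by (intro vs1.span_minimal linear_subspace_linear_preimage[OF B_linear S(1)]) auto
    then have xS: "B x y \<in> S" for y using E(4) by auto
    have zS: "B b z \<in> S" for b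
    proof -
      obtain z' where z': "B v z' = B b w" using exists_lift[OF w] by blast
      have "B b z + B x z' - B x z' \<in> S"
        using second_order_polarized[OF w z z'] S(2) by (intro vs2.subspace_diff[OF S(1)] xS) auto
      then show ?thesis by simp
    qed
    fix a b assume "a \<in> E" "b \<in> E"
    then show "B a b \<in> S" using EE[of a b] zS[of a] zS[of b] B_sym[of z b] by (cases "a = z \<or> b = z") auto
  qed
  have "finite (E - {z})" using E(2) by simp
  from rows_leI[OF this dropped] have "rows_le (r + pairs (card (E - {z})))" .
  moreover have "card (E - {z}) = r - card D - 1" using E by simp
  ultimately show "rows_le (r + pairs (r - card D - 1))" by (simp only:)
qed

section \<open>Codimension of the radical\<close>

definition cols_le :: "nat \<Rightarrow> bool" where
  "cols_le N \<longleftrightarrow> (\<exists>G. finite G \<and> card G \<le> N \<and> (\<forall>x. \<exists>g \<in> vs1.span G. x - g \<in> rad))"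

text \<open>Modulo \<open>rad\<close>, the space \<open>R\<close> shrinks to the line through
  \<open>v\<close>. So a complement of \<open>R\<close> needs only \<open>v\<close> in addition,
  whence the + 1.\<close>

lemma cols_leI:
  assumes D: "vs2.independent D" "vs2.span D = B v ` R"
    and R: "\<And>z. z \<in> R \<Longrightarrow> \<exists>k. z - k *a v \<in> rad"
  shows "cols_le (r - card D + 1)"
proof -
  obtain E where E: "finite E" "card E = r - card D" "vs1.span (E \<union> R) = UNIV"
    by (rule adapted_basis[OF D, of "{}"]) (use D in auto)
  have "\<exists>g \<in> vs1.span (insert v E). x - g \<in> rad" for x
  proof -
    have "x \<in> vs1.span (E \<union> R)" using E(3) by simp
    then obtain e z where x: "x = e + z" "e \<in> vs1.span E" "z \<in> R"
      unfolding vs1.span_Un iffD2[OF vs1.span_eq_iff subspace_R] by blast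
    obtain k where k: "z - k *a v \<in> rad" using R[OF x(3)] by blast
    have "e + k *a v \<in> vs1.span (insert v E)"
      using x(2) vs1.span_mono[of E "insert v E"]
      by (intro vs1.span_add vs1.span_scale vs1.span_base[of v]) auto
    moreover have "x - (e + k *a v) \<in> rad" using k by (simp add: x(1) algebra_simps)
    ultimately show ?thesis by blast
  qed
  moreover have "finite (insert v E)" "card (insert v E) \<le> r - card D + 1"
    using E by (auto simp: card_insert_if)
  ultimately show ?thesis unfolding cols_le_def by blast
qed

lemma basis_image_R:
  obtains D where "vs2.independent D" "vs2.span D = B v ` R" "finite D"
proof -
  obtain D where D: "D \<subseteq> B v ` R" "vs2.independent D" "B v ` R \<subseteq> vs2.span D"
    by (rule vs2.basis_exists)
  have "D \<subseteq> U" using D(1) by blast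
  obtain Bs where "D \<subseteq> Bs" "finite Bs" by (rule basis_U[OF D(2) \<open>D \<subseteq> U\<close>])
  then have "finite D" by (rule finite_subset)
  moreover have "vs2.span D = B v ` R"
    by (rule vs2.span_subspace[OF D(1,3) linear_subspace_image[OF B_linear subspace_R]])
  ultimately show ?thesis using D(2) by (intro that)
qed

lemma rows_le_rank: assumes "R = UNIV" shows "rows_le r"
proof -
  have "rows_le (r + pairs (card ({} :: 'b set)))"
  proof (rule rows_leI)
    fix S x y assume "U \<subseteq> S"
    moreover have "B x y \<in> U" by (rule R_D(1)) (simp add: assms)
    ultimately show "B x y \<in> S" by (rule subsetD)
  qed simp
  moreover have "pairs 0 = 0" unfolding pairs_def by simp
  ultimately show ?thesis by simp
qed

text \<open>The parallelogram identity yields all diagonal values, and polarization then the others;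
  both divide by 2. The hypothesis on \<open>y\<close> is shaped for conditions saying that a linear
  function does not vanish: if such a condition holds at \<open>x\<close> and fails at
  \<open>y\<close>, it holds at \<open>x + y\<close> and at \<open>x - y\<close>.\<close>

lemma R_eq_UNIV:
  assumes 2: "(2::'a) \<noteq> 0" and x: "B x x \<in> U"
    and y: "\<And>y. B y y \<in> U \<or> B (x + y) (x + y) \<in> U \<and> B (x - y) (x - y) \<in> U"
  shows "R = UNIV"
proof -
  have U2: "u \<in> U" if "u + u \<in> U" for u
  proof -
    have "u + u = (2::'a) *b u" using vs2.scale_left_distrib[of 1 1 u] by simp
    then show ?thesis using U_scale_iff[OF 2] that by metis
  qed
  have diag: "B y y \<in> U" for y
  proof (cases "B (x + y) (x + y) \<in> U \<and> B (x - y) (x - y) \<in> U")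
    case True
    then have "B (x + y) (x + y) + B (x - y) (x - y) - (B x x + B x x) \<in> U"
      by (intro U_diff U_add x) auto
    moreover have "B (x + y) (x + y) + B (x - y) (x - y) - (B x x + B x x) = B y y + B y y"
      by (simp add: add_left add_right diff_left diff_right algebra_simps)
    ultimately show ?thesis using U2 by metis
  qed (use y[of y] in blast)
  have "B a b \<in> U" for a b
  proof -
    have "B (a + b) (a + b) - (B a a + B b b) \<in> U" by (intro U_diff U_add diag)
    moreover have "B (a + b) (a + b) - (B a a + B b b) = B a b + B a b"
      by (simp add: add_left add_right B_sym[of b a] algebra_simps)
    ultimately show ?thesis using U2 by metis
  qed
  then show ?thesis by (auto simp: R_def)
qed

text \<open>The condition on the kernel makes the next coefficients explicit:
  \<open>w1 + b *a v\<close> is a kernel vector, and then so is \<open>w2 - b *a y + k *a v\<close>.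
  The latter lies in \<open>R\<close>, and as \<open>B y w2 = - B v w3\<close> and
  \<open>B y v\<close> are in \<open>U\<close>, so is \<open>B y y\<close> multiplied by
  \<open>b\<close>.\<close>

lemma third_order:
  assumes w: "B v w = 0" and ker: "\<And>w'. B v w' = 0 \<Longrightarrow> \<exists>k. B y w' = k *b B v v"
    and b: "B y w = b *b B v v" "b \<noteq> 0"
  shows "B y y \<in> U"
proof -
  obtain w1 w2 w3 where c: "B v w1 = - B y w" "B v w2 = - B y w1" "B v w3 = - B y w2"
    using chain[OF w] by blast
  have "B v (w1 + b *a v) = 0" by (simp add: add_right scale_right c b)
  from ker[OF this] obtain k where k: "B y (w1 + b *a v) = k *b B v v" by blast
  then have w1: "B y w1 = k *b B v v - b *b B y v" by (simp add: add_right scale_right algebra_simps)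
  have "B v (w2 - b *a y + k *a v) = 0"
    by (simp add: add_right diff_right scale_right c w1 B_sym[of y v])
  from R_D(1)[OF kernel_in_R[OF this]]
  have "B y (w2 - b *a y + k *a v) - k *b B y v - B y w2 \<in> U"
    using c(3) U_minus_iff[of "B y w2"] U_I[of w3] B_sym[of y v] U_I[of y]
    by (intro U_diff U_scale) auto
  then have "- (b *b B y y) \<in> U" by (simp add: add_right diff_right scale_right)
  then show ?thesis using b(2) U_minus_iff U_scale_iff by blast
qed

text \<open>A priori the factor depends on \<open>x\<close>. Comparing the factors at
  \<open>x0\<close>, \<open>x\<close> and \<open>x0 + x\<close> settles the case of independent
  \<open>g x0\<close> and \<open>g x\<close>; in the dependent case it suffices that
  \<open>f\<close> vanishes wherever \<open>g\<close> does.\<close>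

lemma proportional:
  assumes lin: "Vector_Spaces.linear s1 s2 f" "Vector_Spaces.linear s1 s2 g"
    and ex: "\<And>x. \<exists>c. f x = c *b g x"
  shows "\<exists>c. \<forall>x. f x = c *b g x"
proof (cases "\<forall>x. g x = 0")
  case True
  then show ?thesis using ex by (metis vs2.scale_zero_right)
next
  case False
  then obtain x0 where x0: "g x0 \<noteq> 0" by blast
  obtain c0 where c0: "f x0 = c0 *b g x0" using ex by blast
  have "f x = c0 *b g x" for x
  proof -
    obtain c where c: "f x = c *b g x" using ex by blast
    obtain d where "f (x0 + x) = d *b g (x0 + x)" using ex by blast
    then have "(c0 - d) *b g x0 = (d - c) *b g x"
      by (simp add: linear_add[OF lin(1)] linear_add[OF lin(2)] c c0 vs2.scale_right_distrib
          vs2.scale_left_diff_distrib algebra_simps)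
    show ?thesis
    proof (cases "c0 = d")
      case True
      then show ?thesis using \<open>(c0 - d) *b g x0 = _\<close> c by auto
    next
      case False
      define k where "k = (d - c) / (c0 - d)"
      have k: "g x0 = k *b g x"
        using arg_cong[OF \<open>(c0 - d) *b g x0 = _\<close>, of "\<lambda>u. inverse (c0 - d) *b u"] False
        by (simp add: k_def divide_inverse mult.commute)
      have "g (x0 - k *a x) = 0"
        by (simp add: linear_diff[OF lin(2)] linear_scale[OF lin(2)] k)
      then have "f (x0 - k *a x) = 0" using ex[of "x0 - k *a x"] by auto
      then have "f x0 = k *b f x" by (simp add: linear_diff[OF lin(1)] linear_scale[OF lin(1)])
      also have "\<dots> = c *b g x0" by (simp add: c k mult.commute)
      finally have "c = c0" using c0 x0 by simp
      then show ?thesis using c by simp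
    qed
  qed
  then show ?thesis by blast
qed

section \<open>The numerical bounds and the classification\<close>

lemma pairs_bounds:
  "(2::'a) \<noteq> 0 \<Longrightarrow> 1 \<le> d \<Longrightarrow> d \<le> n \<Longrightarrow> n + pairs (n - d) \<le> (n\<^sup>2 + n) div 2"
  "(2::'a) \<noteq> 0 \<Longrightarrow> 2 \<le> d \<Longrightarrow> d \<le> n \<Longrightarrow> n + pairs (n - d) \<le> (n\<^sup>2 - n) div 2 + 1"
  "(2::'a) = 0 \<Longrightarrow> n + pairs (n - d) \<le> (n\<^sup>2 + n) div 2"
  "(2::'a) = 0 \<Longrightarrow> 1 \<le> d \<Longrightarrow> d \<le> n \<Longrightarrow> n + pairs (n - d) \<le> (n\<^sup>2 - n) div 2 + 1"
proof -
  have mono1: "k * (k + 1) div 2 \<le> k' * (k' + 1) div 2" if "k \<le> k'" for k k' :: nat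
    by (intro div_le_mono mult_mono) (use that in auto)
  have mono2: "k * (k - 1) div 2 \<le> k' * (k' - 1) div 2" if "k \<le> k'" for k k' :: nat
    by (intro div_le_mono mult_mono) (use that in auto)
  have e1: "Suc k + k * (k + 1) div 2 = ((Suc k)\<^sup>2 + Suc k) div 2"
    "Suc (Suc k) + k * (k + 1) div 2 = ((Suc (Suc k))\<^sup>2 - Suc (Suc k)) div 2 + 1"
    "k + k * (k - 1) div 2 = (k\<^sup>2 + k) div 2"
    "Suc k + k * (k - 1) div 2 = ((Suc k)\<^sup>2 - Suc k) div 2 + 1" for k :: nat
  proof -
    have "k + k * (k - 1) div 2 = (2 * k + k * (k - 1)) div 2" by simp
    also have "2 * k + k * (k - 1) = k\<^sup>2 + k" by (cases k) (auto simp: power2_eq_square)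
    finally show a: "k + k * (k - 1) div 2 = (k\<^sup>2 + k) div 2" .
    have "Suc k + k * (k + 1) div 2 = (2 * Suc k + k * (k + 1)) div 2" by simp
    then show "Suc k + k * (k + 1) div 2 = ((Suc k)\<^sup>2 + Suc k) div 2"
      by (simp add: power2_eq_square algebra_simps)
    have "Suc (Suc k) + k * (k + 1) div 2 = (2 * Suc k + k * (k + 1)) div 2 + 1" by simp
    also have "2 * Suc k + k * (k + 1) = (Suc (Suc k))\<^sup>2 - Suc (Suc k)"
      by (simp add: power2_eq_square)
    finally show "Suc (Suc k) + k * (k + 1) div 2 = ((Suc (Suc k))\<^sup>2 - Suc (Suc k)) div 2 + 1" .
    show "Suc k + k * (k - 1) div 2 = ((Suc k)\<^sup>2 - Suc k) div 2 + 1"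
      using a by (simp add: power2_eq_square)
  qed
  show "n + pairs (n - d) \<le> (n\<^sup>2 + n) div 2" if "(2::'a) \<noteq> 0" "1 \<le> d" "d \<le> n"
    using that mono1[OF diff_le_mono2[OF that(2), of n]] e1(1)[of "n - 1"]
    by (simp add: pairs_def del: mult_Suc_right add_Suc_right)
  show "n + pairs (n - d) \<le> (n\<^sup>2 - n) div 2 + 1" if "(2::'a) \<noteq> 0" "2 \<le> d" "d \<le> n"
  proof -
    have "n = Suc (Suc (n - 2))" using that(2,3) by linarith
    then obtain k where n: "n = Suc (Suc k)" by blast
    have "pairs (n - d) \<le> k * (k + 1) div 2"
      using that mono1[OF diff_le_mono2[OF that(2), of n]] by (simp add: pairs_def n)
    then show ?thesis using e1(2)[of k] by (simp only: n)
  qed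
  show "n + pairs (n - d) \<le> (n\<^sup>2 + n) div 2" if "(2::'a) = 0"
    using that mono2[of "n - d" n] e1(3)[of n] by (simp add: pairs_def)
  show "n + pairs (n - d) \<le> (n\<^sup>2 - n) div 2 + 1" if "(2::'a) = 0" "1 \<le> d" "d \<le> n"
    using that mono2[OF diff_le_mono2[OF that(2), of n]] e1(4)[of "n - 1"] by (simp add: pairs_def)
qed

text \<open>These serve the case \<open>R = UNIV\<close>, in which all values of the form lie in
  \<open>U\<close> and \<open>r\<close> rows suffice.\<close>

lemma rank_bounds: fixes n :: nat shows "n \<le> (n\<^sup>2 + n) div 2" "n \<le> (n\<^sup>2 - n) div 2 + 1"
proof -
  have "2 * n \<le> n\<^sup>2 + n" by (cases n) (auto simp: power2_eq_square)
  then show "n \<le> (n\<^sup>2 + n) div 2" by linarith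
  have "2 * n \<le> (n\<^sup>2 - n) + 2"
  proof (cases "n \<le> 2")
    case True
    then have "n = 0 \<or> n = 1 \<or> n = 2" by auto
    then show ?thesis by auto
  next
    case False
    then have "3 * n \<le> n\<^sup>2" by (simp add: power2_eq_square)
    then show ?thesis by linarith
  qed
  then show "n \<le> (n\<^sup>2 - n) div 2 + 1" by linarith
qed

lemma classification_char_2:
  assumes 2: "(2::'a) = 0"
  shows "rows_le ((r\<^sup>2 + r) div 2) \<and> (rows_le ((r\<^sup>2 - r) div 2 + 1) \<or> cols_le (r + 1))"
proof -
  obtain D where D: "vs2.independent D" "vs2.span D = B v ` R" "finite D"
    by (rule basis_image_R)
  note codim = rows_le_codim[OF D(1,2)]
  have "rows_le ((r\<^sup>2 + r) div 2)"
    by (rule rows_le_mono[OF codim(1) pairs_bounds(3)[OF 2]])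
  moreover have "rows_le ((r\<^sup>2 - r) div 2 + 1) \<or> cols_le (r + 1)"
  proof (cases "card D = 0")
    case False
    then show ?thesis
      using rows_le_mono[OF codim(1) pairs_bounds(4)[OF 2 _ codim(2)]] by simp
  next
    case True
    then have D0: "D = {}" using D(3) by simp
    have ker: "B v z = 0" if "z \<in> R" for z using D(2) that unfolding D0 by auto
    show ?thesis
    proof (cases "\<exists>w x z. B v w = 0 \<and> B v z = B x w \<and> (\<forall>c. z - c *a x \<notin> R)")
      case True
      then obtain w x z where "B v w = 0" "B v z = B x w" "\<And>c. z - c *a x \<notin> R" by blast
      note red = rows_le_reduced[OF D(1,2) this]
      have "r + pairs (r - 1) \<le> (r\<^sup>2 - r) div 2 + 1"
        using red(2) by (intro pairs_bounds(4)[OF 2]) auto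
      from rows_le_mono[OF _ this] red(1) show ?thesis unfolding D0 by simp
    next
      case False
      have "\<exists>k. w - k *a v \<in> rad" if w: "w \<in> R" for w
      proof -
        have "\<exists>c. B w x = c *b B v x" for x
        proof -
          obtain z where z: "B v z = B x w" using exists_lift[OF ker[OF w], of x] by blast
          then obtain c where "z - c *a x \<in> R" using False ker[OF w] by blast
          from ker[OF this] have "B v z = c *b B v x" by (simp add: diff_right scale_right)
          then show ?thesis using z B_sym by metis
        qed
        from proportional[OF B_linear B_linear this]
        obtain c where "\<forall>x. B w x = c *b B v x" by blast
        then have "B y (w - c *a v) = 0" for y
          unfolding diff_right scale_right B_sym[of y w] B_sym[of y v] by simp
        then have "w - c *a v \<in> rad" by (simp add: rad_def)
        then show ?thesis ..
      qed
      from cols_leI[OF D(1,2) this] show ?thesis unfolding D0 by simp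
    qed
  qed
  ultimately show ?thesis by blast
qed

text \<open>Degenerate configurations are excluded by showing that they force
  \<open>R = UNIV\<close>, where \<open>r\<close> rows suffice. What survives with
  \<open>card D = 1\<close> and nothing to drop is that the kernel of \<open>B v\<close> lies in
  \<open>rad\<close> and \<open>B v\<close> maps \<open>R\<close> onto the line of
  \<open>B v v\<close>.\<close>

lemma classification_char_not_2:
  assumes 2: "(2::'a) \<noteq> 0"
  shows "rows_le ((r\<^sup>2 + r) div 2) \<and> (rows_le ((r\<^sup>2 - r) div 2 + 1) \<or> cols_le r)"
proof (cases "R = UNIV")
  case True
  then have "rows_le r" by (rule rows_le_rank)
  then show ?thesis
    by (intro conjI disjI1; elim rows_le_mono) (rule rank_bounds)+
next
  case False
  obtain D where D: "vs2.independent D" "vs2.span D = B v ` R" "finite D"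
    by (rule basis_image_R)
  note codim = rows_le_codim[OF D(1,2)]
  \<comment> \<open>If \<open>v\<close> is in the kernel, \<open>second_order\<close> applies with w
    = v, and each \<open>y\<close> is its own lift by symmetry.\<close>
  have vv: "B v v \<noteq> 0"
  proof
    assume "B v v = 0"
    then have "B y y \<in> U" for y by (rule second_order) (rule B_sym)
    then have "R = UNIV" by (intro R_eq_UNIV[OF 2, of 0] disjI1)
    with False show False ..
  qed
  have "B v v \<in> vs2.span D" unfolding D(2) using v_in_R by (rule imageI)
  then have D1: "1 \<le> card D" using vv D(3) by (cases "D = {}") (auto simp: Suc_le_eq card_gt_0_iff)
  have "rows_le ((r\<^sup>2 + r) div 2)"
    by (rule rows_le_mono[OF codim(1) pairs_bounds(1)[OF 2 D1 codim(2)]])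
  moreover have "rows_le ((r\<^sup>2 - r) div 2 + 1) \<or> cols_le r"
  proof (cases "2 \<le> card D")
    case True
    then show ?thesis using rows_le_mono[OF codim(1) pairs_bounds(2)[OF 2 True codim(2)]] by simp
  next
    case False
    then have "card D = 1" using D1 by simp
    then obtain u where u: "D = {u}" using card_1_singletonE by blast
    have img: "\<exists>k. B v z = k *b B v v" if z: "z \<in> R" for z
    proof -
      obtain a b where "B v z = a *b u" "B v v = b *b u"
        using imageI[OF z, of "B v"] imageI[OF v_in_R, of "B v"]
        unfolding D(2)[symmetric] u vs2.span_singleton by blast
      then show ?thesis using vv by (intro exI[of _ "a / b"]) auto
    qed
    show ?thesis
    proof (cases "\<exists>w x z. B v w = 0 \<and> B v z = B x w \<and> (\<forall>c. z - c *a x \<notin> R)")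
      case True
      then obtain w x z where "B v w = 0" "B v z = B x w" "\<And>c. z - c *a x \<notin> R" by blast
      note red = rows_le_reduced[OF D(1,2) this]
      have "r + pairs (r - 2) \<le> (r\<^sup>2 - r) div 2 + 1"
        using red(2) \<open>card D = 1\<close> by (intro pairs_bounds(2)[OF 2]) auto
      from rows_le_mono[OF _ this] red(1) \<open>card D = 1\<close> show ?thesis by (simp add: numeral_2_eq_2)
    next
      case no_reduction: False
      \<comment> \<open>A lift outside \<open>R\<close> is a nonzero multiple of its argument modulo
        \<open>R\<close>, and \<open>second_order\<close> then puts the diagonal value there into
        \<open>U\<close>. Lifts add and subtract along with their arguments, so
        \<open>R_eq_UNIV\<close> applies.\<close>
      have z_in_R: "z \<in> R" if w: "B v w = 0" and z: "B v z = B x w" for w x z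
      proof (rule ccontr)
        assume zR: "z \<notin> R"
        have diag: "B y y \<in> U" if z': "B v z' = B y w" "z' \<notin> R" for y z'
        proof -
          obtain c where c: "z' - c *a y \<in> R" using no_reduction w z'(1) by blast
          have "c \<noteq> 0" using c z'(2) by auto
          have "B y z' - B y (z' - c *a y) \<in> U"
            by (intro U_diff second_order[OF w z'(1)] R_D(1) c)
          then show ?thesis using \<open>c \<noteq> 0\<close> U_scale_iff by (simp add: diff_right scale_right)
        qed
        have "R = UNIV"
        proof (rule R_eq_UNIV[OF 2 diag[OF z zR]])
          fix y
          obtain z' where z': "B v z' = B y w" using exists_lift[OF w] by blast
          show "B y y \<in> U \<or> B (x + y) (x + y) \<in> U \<and> B (x - y) (x - y) \<in> U"
          proof (cases "z' \<in> R")
            case True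
            have "z + z' \<notin> R" "z - z' \<notin> R"
              using zR R_diff[OF _ True, of "z + z'"] R_add[OF _ True, of "z - z'"] by auto
            then show ?thesis
              using diag[of "z + z'" "x + y"] diag[of "z - z'" "x - y"] z z'
              by (simp add: add_left add_right diff_left diff_right)
          qed (use diag[OF z'] in blast)
        qed
        with \<open>R \<noteq> UNIV\<close> show False ..
      qed
      have ker: "\<exists>k. B x w = k *b B v v" if "B v w = 0" for x w
        using exists_lift[OF that, of x] z_in_R[OF that] img by metis
      \<comment> \<open>The same argument with \<open>third_order\<close> in place of
        \<open>second_order\<close>: the factor of \<open>B x w\<close> with respect to
        \<open>B v v\<close> is linear in \<open>x\<close>, so if it is nonzero at \<open>x\<close>
        and zero at \<open>y\<close>, it is nonzero at \<open>x + y\<close> and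
        \<open>x - y\<close>.\<close>
      have rad: "w \<in> rad" if w: "B v w = 0" for w
      proof (rule ccontr)
        assume "w \<notin> rad"
        then obtain x where "B x w \<noteq> 0" by (auto simp: rad_def)
        then obtain b where b: "B x w = b *b B v v" "b \<noteq> 0"
          using ker[OF w, of x] by auto
        have "R = UNIV"
        proof (rule R_eq_UNIV[OF 2 third_order[OF w ker b]])
          fix y
          obtain c where c: "B y w = c *b B v v" using ker[OF w] by blast
          show "B y y \<in> U \<or> B (x + y) (x + y) \<in> U \<and> B (x - y) (x - y) \<in> U"
          proof (cases "c = 0")
            case True
            then show ?thesis using b c
              by (intro disjI2 conjI third_order[OF w ker, where b = b]) (auto simp: add_left diff_left)
          qed (use third_order[OF w ker c] in blast)
        qed
        with \<open>R \<noteq> UNIV\<close> show False ..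
      qed
      have "\<exists>k. z - k *a v \<in> rad" if z: "z \<in> R" for z
      proof -
        obtain k where "B v z = k *b B v v" using img[OF z] by blast
        then have "z - k *a v \<in> rad" by (intro rad) (simp add: diff_right scale_right)
        then show ?thesis ..
      qed
      from cols_leI[OF D(1,2) this] show ?thesis
        using \<open>card D = 1\<close> codim(2) by simp
    qed
  qed
  ultimately show ?thesis by blast
qed

end

section \<open>Quadratic forms as polynomials\<close>

lemma poly_mapping_eq_sum_single:
  "p = (\<Sum>t \<in> Poly_Mapping.keys p. Poly_Mapping.single t (Poly_Mapping.lookup p t))"
  by (rule poly_mapping_eqI) (auto simp: lookup_sum lookup_single when_def in_keys_iff)

definition monomial_value :: "(nat \<Rightarrow> 'r::comm_semiring_1) \<Rightarrow> (nat \<Rightarrow>\<^sub>0 nat) \<Rightarrow> 'r" where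
  "monomial_value f t = (\<Prod>i \<in> Poly_Mapping.keys t. f i ^ Poly_Mapping.lookup t i)"

lemma monomial_value_superset:
  assumes "finite I" "Poly_Mapping.keys t \<subseteq> I"
  shows "monomial_value f t = (\<Prod>i \<in> I. f i ^ Poly_Mapping.lookup t i)"
  unfolding monomial_value_def
  by (rule prod.mono_neutral_left) (use assms in \<open>auto simp: in_keys_iff\<close>)

lemma monomial_value_add: "monomial_value f (s + t) = monomial_value f s * monomial_value f t"
proof -
  let ?I = "Poly_Mapping.keys s \<union> Poly_Mapping.keys t"
  have "Poly_Mapping.keys (s + t) \<subseteq> ?I" by (rule keys_add)
  then show ?thesis
    by (simp add: monomial_value_superset[of ?I] lookup_add power_add prod.distrib)
qed

lemma monomial_value_single [simp]: "monomial_value f (Poly_Mapping.single i k) = f i ^ k"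
  by (cases "k = 0") (auto simp: monomial_value_def)

lemma monomial_value_0 [simp]: "monomial_value f 0 = 1"
  by (simp add: monomial_value_def)

text \<open>One evaluation map covers substitution, the embedding into the fraction field and the
  expansion in a parameter t: \<open>h\<close> acts on coefficients, \<open>f\<close> on
  indeterminates.\<close>

definition eval_mpoly ::
  "('k::zero \<Rightarrow> 'r::comm_semiring_1) \<Rightarrow> (nat \<Rightarrow> 'r) \<Rightarrow> 'k mpoly \<Rightarrow> 'r" where
  "eval_mpoly h f p = (\<Sum>t \<in> Poly_Mapping.keys p. h (Poly_Mapping.lookup p t) * monomial_value f t)"

lemma subst_poly_eq_eval_mpoly: "subst_poly f p = eval_mpoly Const f p"
  by (simp add: subst_poly_def eval_mpoly_def monomial_value_def)

lemma Const_0 [simp]: "Const 0 = 0"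
  and Const_1 [simp]: "Const 1 = 1"
  and Const_add: "Const (a + b) = Const a + Const b"
  and Const_mult: "Const (a * b) = Const a * Const b"
  by (simp_all add: Const_def single_add mult_single)

lemma comm_ring_hom_Const: "comm_ring_hom (Const :: 'k::comm_ring_1 \<Rightarrow> 'k mpoly)"
  by unfold_locales (simp_all add: Const_add Const_mult)

context comm_ring_hom
begin

lemma eval_mpoly_superset:
  assumes "finite S" "Poly_Mapping.keys p \<subseteq> S"
  shows "eval_mpoly hom f p = (\<Sum>t \<in> S. hom (Poly_Mapping.lookup p t) * monomial_value f t)"
  unfolding eval_mpoly_def
  by (rule sum.mono_neutral_left) (use assms in \<open>auto simp: in_keys_iff\<close>)

lemma eval_mpoly_add: "eval_mpoly hom f (p + q) = eval_mpoly hom f p + eval_mpoly hom f q"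
proof -
  let ?S = "Poly_Mapping.keys p \<union> Poly_Mapping.keys q"
  have "Poly_Mapping.keys (p + q) \<subseteq> ?S" by (rule keys_add)
  then show ?thesis
    by (simp add: eval_mpoly_superset[of ?S] lookup_add hom_add sum.distrib distrib_right)
qed

lemma eval_mpoly_0 [simp]: "eval_mpoly hom f 0 = 0"
  by (simp add: eval_mpoly_def)

lemma eval_mpoly_sum: "eval_mpoly hom f (\<Sum>x \<in> A. p x) = (\<Sum>x \<in> A. eval_mpoly hom f (p x))"
  by (induction A rule: infinite_finite_induct) (simp_all add: eval_mpoly_add)

lemma eval_mpoly_single:
  "eval_mpoly hom f (Poly_Mapping.single t c) = hom c * monomial_value f t"
  by (cases "c = 0") (auto simp: eval_mpoly_def)

lemma eval_mpoly_mult: "eval_mpoly hom f (p * q) = eval_mpoly hom f p * eval_mpoly hom f q"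
proof -
  have "p * q = (\<Sum>s \<in> Poly_Mapping.keys p. Poly_Mapping.single s (Poly_Mapping.lookup p s)) *
      (\<Sum>t \<in> Poly_Mapping.keys q. Poly_Mapping.single t (Poly_Mapping.lookup q t))"
    using poly_mapping_eq_sum_single[of p] poly_mapping_eq_sum_single[of q] by simp
  then show ?thesis
    by (simp add: sum_product mult_single eval_mpoly_sum eval_mpoly_single hom_mult
        monomial_value_add eval_mpoly_def[of hom f p] eval_mpoly_def[of hom f q] ac_simps)
qed

lemma eval_mpoly_Const [simp]: "eval_mpoly hom f (Const c) = hom c"
  by (simp add: Const_def eval_mpoly_single)

lemma eval_mpoly_Var [simp]: "eval_mpoly hom f (Var i) = f i"
  by (simp add: Var_def eval_mpoly_single)

lemma comm_ring_hom_eval_mpoly: "comm_ring_hom (eval_mpoly hom f)"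
  using eval_mpoly_Const[of f 1]
  by unfold_locales (simp_all add: eval_mpoly_add eval_mpoly_mult)

end

lemma single_eq_Const_mult_monomial:
  "Poly_Mapping.single t c = Const c * monomial_value Var (t :: nat \<Rightarrow>\<^sub>0 nat)"
  for c :: "'k::comm_ring_1"
proof -
  have pow: "Var i ^ k = Poly_Mapping.single (Poly_Mapping.single i k) (1 :: 'k)" for i k
    by (induction k) (auto simp: Var_def mult_single single_add[symmetric])
  have "(\<Prod>i \<in> I. Var i ^ k i) = Poly_Mapping.single (\<Sum>i \<in> I. Poly_Mapping.single i (k i)) (1 :: 'k)"
    if "finite I" for I k
    using that by induction (auto simp: pow mult_single)
  then have "monomial_value Var t = Poly_Mapping.single t (1 :: 'k)"
    unfolding monomial_value_def using poly_mapping_eq_sum_single[of t] by simp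
  then show ?thesis by (simp add: Const_def mult_single)
qed

text \<open>Constants and indeterminates generate the polynomial ring. The lemma serves to identify
  two homomorphisms by their values there.\<close>

lemma comm_ring_hom_eq_eval_mpoly:
  assumes "comm_ring_hom g"
  shows "g p = eval_mpoly (\<lambda>c. g (Const c)) (\<lambda>i. g (Var i)) p"
proof -
  interpret comm_ring_hom g by fact
  have "g p = g (\<Sum>t \<in> Poly_Mapping.keys p. Poly_Mapping.single t (Poly_Mapping.lookup p t))"
    using poly_mapping_eq_sum_single[of p] by simp
  then show ?thesis
    by (simp add: hom_sum single_eq_Const_mult_monomial hom_mult eval_mpoly_def
        monomial_value_def hom_prod hom_power)
qed

text \<open>The coefficients are not normalized and hence not unique. Symmetric ones cannot always
  be had in characteristic 2, where they lose the mixed terms.\<close>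

definition quadratic_form :: "nat \<Rightarrow> (nat \<Rightarrow> nat \<Rightarrow> 'k) \<Rightarrow> 'k::comm_ring_1 mpoly" where
  "quadratic_form n q = (\<Sum>a<n. \<Sum>b<n. Const (q a b) * Var a * Var b)"

lemma quadratic_form_add:
  "quadratic_form n (\<lambda>a b. q a b + q' a b) = quadratic_form n q + quadratic_form n q'"
  by (simp add: quadratic_form_def Const_add distrib_right sum.distrib)

lemma quadratic_form_sum:
  "quadratic_form n (\<lambda>a b. \<Sum>k \<in> A. q k a b) = (\<Sum>k \<in> A. quadratic_form n (q k))"
  by (induction A rule: infinite_finite_induct)
    (simp_all add: quadratic_form_add, simp_all add: quadratic_form_def)

lemma Const_mult_quadratic_form:
  "Const c * quadratic_form n q = quadratic_form n (\<lambda>a b. c * q a b)"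
  by (simp add: quadratic_form_def sum_distrib_left Const_mult mult.assoc)

lemma quadratic_form_single:
  assumes "a < n" "b < n"
  shows "quadratic_form n (\<lambda>x y. if x = a \<and> y = b then c else 0) = Const c * Var a * Var b"
proof -
  have "Const (if x = a \<and> y = b then c else 0) * Var x * Var y =
      (if y = b then if x = a then Const c * Var a * Var b else 0 else 0)" for x y
    by simp
  then show ?thesis using assms by (simp add: quadratic_form_def)
qed

section \<open>Homogeneous polynomials of degree 2 as quadratic forms\<close>

lemma mon_degree_superset:
  assumes "finite I" "Poly_Mapping.keys t \<subseteq> I"
  shows "mon_degree t = (\<Sum>i \<in> I. Poly_Mapping.lookup t i)"
  unfolding mon_degree_def
  by (rule sum.mono_neutral_left) (use assms in \<open>auto simp: in_keys_iff\<close>)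

lemma mon_degree_add: "mon_degree (s + t) = mon_degree s + mon_degree t"
proof -
  let ?I = "Poly_Mapping.keys s \<union> Poly_Mapping.keys t"
  have "Poly_Mapping.keys (s + t) \<subseteq> ?I" by (rule keys_add)
  then show ?thesis by (simp add: mon_degree_superset[of ?I] lookup_add sum.distrib)
qed

lemma mon_degree_single [simp]: "mon_degree (Poly_Mapping.single i k) = k"
  by (cases "k = 0") (auto simp: mon_degree_def)

lemma mon_degree_SucE:
  assumes "mon_degree t = Suc d"
  obtains a s where "t = Poly_Mapping.single a 1 + s" "mon_degree s = d"
    "a \<in> Poly_Mapping.keys t" "Poly_Mapping.keys s \<subseteq> Poly_Mapping.keys t"
proof -
  have "Poly_Mapping.keys t \<noteq> {}" using assms by (auto simp: mon_degree_def)
  then obtain a where a: "a \<in> Poly_Mapping.keys t" by blast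
  define s where "s = t - Poly_Mapping.single a 1"
  have t: "t = Poly_Mapping.single a 1 + s"
    using a by (intro poly_mapping_eqI)
      (auto simp: s_def lookup_add lookup_minus lookup_single when_def in_keys_iff)
  have "mon_degree s = d" using assms unfolding t mon_degree_add by simp
  moreover have "Poly_Mapping.keys s \<subseteq> Poly_Mapping.keys t"
    by (auto simp: s_def in_keys_iff lookup_minus)
  ultimately show ?thesis using that t a by blast
qed

lemma mon_degree_2E:
  assumes "mon_degree t = 2"
  obtains a b where "t = Poly_Mapping.single a 1 + Poly_Mapping.single b 1"
    "a \<in> Poly_Mapping.keys t" "b \<in> Poly_Mapping.keys t"
proof -
  obtain a s where a: "t = Poly_Mapping.single a 1 + s" "mon_degree s = Suc 0"
    "a \<in> Poly_Mapping.keys t" "Poly_Mapping.keys s \<subseteq> Poly_Mapping.keys t"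
    using mon_degree_SucE[of t "Suc 0"] assms by (auto simp: numeral_2_eq_2)
  obtain b u where b: "s = Poly_Mapping.single b 1 + u" "mon_degree u = 0" "b \<in> Poly_Mapping.keys s"
    using mon_degree_SucE[OF a(2)] by blast
  have "u = 0" using b(2) by (intro poly_mapping_eqI) (auto simp: mon_degree_def in_keys_iff)
  then show ?thesis using that a b by auto
qed

lemma Const_mult_Var_mult_Var:
  "Const c * Var a * Var b =
    Poly_Mapping.single (Poly_Mapping.single a 1 + Poly_Mapping.single b 1) c"
  for c :: "'k::comm_ring_1"
  by (simp add: Const_def Var_def mult_single)

lemma homogeneous_2_eq_quadratic_form:
  fixes p :: "'k::comm_ring_1 mpoly"
  assumes "p \<in> polys_in n" "homogeneous 2 p"
  shows "\<exists>q. p = quadratic_form n q"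
proof -
  have "\<exists>q. (\<Sum>t \<in> T. Poly_Mapping.single t (Poly_Mapping.lookup p t)) = quadratic_form n q"
    if "finite T" "T \<subseteq> Poly_Mapping.keys p" for T
    using that
  proof induction
    case empty
    have "quadratic_form n (\<lambda>_ _. 0 :: 'k) = 0" by (simp add: quadratic_form_def)
    then show ?case by (intro exI[of _ "\<lambda>_ _. 0"]) simp
  next
    case (insert t T)
    have t: "t \<in> Poly_Mapping.keys p" using insert by simp
    obtain a b where ab: "t = Poly_Mapping.single a 1 + Poly_Mapping.single b 1"
      "a \<in> Poly_Mapping.keys t" "b \<in> Poly_Mapping.keys t"
      using assms(2) t mon_degree_2E unfolding homogeneous_def by metis
    have "a < n" "b < n" using assms(1) t ab unfolding polys_in_def by auto
    note q = quadratic_form_single[OF this, of "Poly_Mapping.lookup p t"]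
    from insert obtain q' where
      "(\<Sum>t \<in> T. Poly_Mapping.single t (Poly_Mapping.lookup p t)) = quadratic_form n q'" by auto
    then have "(\<Sum>t \<in> insert t T. Poly_Mapping.single t (Poly_Mapping.lookup p t)) =
        quadratic_form n (\<lambda>x y. (if x = a \<and> y = b then Poly_Mapping.lookup p t else 0) + q' x y)"
      using insert(1,2) ab(1) by (simp add: quadratic_form_add q Const_mult_Var_mult_Var)
    then show ?case by blast
  qed
  from this[of "Poly_Mapping.keys p"] show ?thesis
    using poly_mapping_eq_sum_single[of p] by simp
qed

section \<open>Jacobians and linear substitutions\<close>

lemma pderiv_var_superset:
  fixes p :: "'k::comm_ring_1 mpoly"
  assumes "finite S" "Poly_Mapping.keys p \<subseteq> S"
  shows "pderiv_var j p = (\<Sum>t \<in> S. Poly_Mapping.single (t - Poly_Mapping.single j 1)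
     (of_nat (Poly_Mapping.lookup t j) * Poly_Mapping.lookup p t))"
  unfolding pderiv_var_def
  by (rule sum.mono_neutral_left) (use assms in \<open>auto simp: in_keys_iff\<close>)

lemma pderiv_var_add: "pderiv_var j (p + q) = pderiv_var j p + pderiv_var j q"
  for p q :: "'k::comm_ring_1 mpoly"
proof -
  let ?S = "Poly_Mapping.keys p \<union> Poly_Mapping.keys q"
  have "Poly_Mapping.keys (p + q) \<subseteq> ?S" by (rule keys_add)
  then show ?thesis
    by (simp add: pderiv_var_superset[of ?S] lookup_add single_add distrib_left sum.distrib)
qed

lemma pderiv_var_sum: "pderiv_var j (\<Sum>x \<in> A. p x) = (\<Sum>x \<in> A. pderiv_var j (p x))"
  for p :: "_ \<Rightarrow> 'k::comm_ring_1 mpoly"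
  by (induction A rule: infinite_finite_induct) (auto simp: pderiv_var_add, auto simp: pderiv_var_def)

lemma pderiv_var_single:
  "pderiv_var j (Poly_Mapping.single t c) =
    Poly_Mapping.single (t - Poly_Mapping.single j 1) (of_nat (Poly_Mapping.lookup t j) * c)"
  for c :: "'k::comm_ring_1"
  by (cases "c = 0") (auto simp: pderiv_var_def)

lemma pderiv_var_quadratic_monomial:
  "pderiv_var j (Const c * Var a * Var b) =
    (if a = j then Const c * Var b else 0) + (if b = j then Const c * Var a else 0)"
  for c :: "'k::comm_ring_1"
proof -
  have lin: "Const c * Var i = Poly_Mapping.single (Poly_Mapping.single i 1) c" for i
    by (simp add: Const_def Var_def mult_single)
  show ?thesis
    unfolding Const_mult_Var_mult_Var pderiv_var_single
    unfolding lin
    by (cases "a = j"; cases "b = j")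
      (simp_all add: lookup_add lookup_single single_add[symmetric] single_diff[symmetric])
qed

lemma pderiv_var_quadratic_form:
  fixes q :: "nat \<Rightarrow> nat \<Rightarrow> 'k::comm_ring_1"
  assumes "j < n"
  shows "pderiv_var j (quadratic_form n q) = (\<Sum>b<n. Const (q j b + q b j) * Var b)"
proof -
  have "pderiv_var j (quadratic_form n q) =
      (\<Sum>a<n. if a = j then \<Sum>b<n. Const (q j b) * Var b else 0) +
      (\<Sum>a<n. \<Sum>b<n. if b = j then Const (q a j) * Var a else 0)"
    unfolding quadratic_form_def pderiv_var_sum pderiv_var_quadratic_monomial sum.distrib
    by (intro arg_cong2[of _ _ _ _ "(+)"] sum.cong refl) (auto intro!: sum.cong)
  then show ?thesis
    using assms by (simp add: Const_add distrib_right sum.distrib)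
qed

lemma linear_transform_quadratic_form:
  fixes S T :: "'k::comm_ring_1 mat"
  assumes S: "S \<in> carrier_mat m m" and T: "T \<in> carrier_mat n n" and H: "H \<in> carrier_vec m"
    and q: "\<And>k. k < m \<Longrightarrow> H $ k = quadratic_form n (q k)" and i: "i < m"
  shows "linear_transform S T H $ i = quadratic_form n
    (\<lambda>c d. \<Sum>k<m. S $$ (i, k) * (\<Sum>a<n. \<Sum>b<n. q k a b * T $$ (a, c) * T $$ (b, d)))"
proof -
  interpret Const: comm_ring_hom "Const :: 'k \<Rightarrow> 'k mpoly" by (rule comm_ring_hom_Const)
  define X :: "nat \<Rightarrow> 'k mpoly" where
    "X a = (map_mat Const T *\<^sub>v vec (dim_col T) Var) $ a" for a
  have X: "X a = (\<Sum>c<n. Const (T $$ (a, c)) * Var c)" if "a < n" for a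
    using that T by (simp add: X_def scalar_prod_def atLeast0LessThan)
  have sub: "subst_poly X (H $ k) = quadratic_form n
      (\<lambda>c d. \<Sum>a<n. \<Sum>b<n. q k a b * T $$ (a, c) * T $$ (b, d))" if k: "k < m" for k
  proof -
    interpret X: comm_ring_hom "eval_mpoly Const X" by (rule Const.comm_ring_hom_eval_mpoly)
    have "subst_poly X (H $ k) = (\<Sum>a<n. \<Sum>b<n. Const (q k a b) * X a * X b)"
      by (simp add: subst_poly_eq_eval_mpoly q[OF k] quadratic_form_def X.hom_sum X.hom_mult)
    also have "\<dots> = (\<Sum>a<n. \<Sum>b<n. \<Sum>c<n. \<Sum>d<n.
        Const (q k a b * T $$ (a, c) * T $$ (b, d)) * Var c * Var d)"
      by (simp add: X sum_product sum_distrib_left sum_distrib_right Const_mult ac_simps)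
    also have "\<dots> = (\<Sum>a<n. \<Sum>c<n. \<Sum>b<n. \<Sum>d<n.
        Const (q k a b * T $$ (a, c) * T $$ (b, d)) * Var c * Var d)"
      by (rule sum.cong[OF refl]) (rule sum.swap)
    also have "\<dots> = (\<Sum>c<n. \<Sum>a<n. \<Sum>d<n. \<Sum>b<n.
        Const (q k a b * T $$ (a, c) * T $$ (b, d)) * Var c * Var d)"
      by (rule trans[OF sum.swap], rule sum.cong[OF refl], rule sum.cong[OF refl]) (rule sum.swap)
    also have "\<dots> = (\<Sum>c<n. \<Sum>d<n. \<Sum>a<n. \<Sum>b<n.
        Const (q k a b * T $$ (a, c) * T $$ (b, d)) * Var c * Var d)"
      by (rule sum.cong[OF refl]) (rule sum.swap)
    finally show ?thesis
      by (simp add: quadratic_form_def Const.hom_sum sum_distrib_right)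
  qed
  have "linear_transform S T H $ i = (\<Sum>k<m. Const (S $$ (i, k)) * subst_poly X (H $ k))"
    using S H i
    by (simp add: linear_transform_def X_def[abs_def] scalar_prod_def atLeast0LessThan Let_def)
  also have "\<dots> = quadratic_form n
      (\<lambda>c d. \<Sum>k<m. S $$ (i, k) * (\<Sum>a<n. \<Sum>b<n. q k a b * T $$ (a, c) * T $$ (b, d)))"
    by (simp add: sub Const_mult_quadratic_form) (rule quadratic_form_sum[symmetric])
  finally show ?thesis .
qed

lemma dim_linear_transform [simp]: "dim_vec (linear_transform S T H) = dim_row S"
  by (simp add: linear_transform_def Let_def)

text \<open>Only the symmetrized coefficients enter. \<open>T\<close> acts on them by congruence and
  \<open>S\<close> by combining the components, so zero rows and columns can be read off from the
  polar form.\<close>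

lemma jacobian_linear_transform:
  fixes S T :: "'k::comm_ring_1 mat"
  assumes S: "S \<in> carrier_mat m m" and T: "T \<in> carrier_mat n n" and H: "H \<in> carrier_vec m"
    and q: "\<And>k. k < m \<Longrightarrow> H $ k = quadratic_form n (q k)" and ij: "i < m" "j < n"
  shows "jacobian n (linear_transform S T H) $$ (i, j) =
    (\<Sum>d<n. Const (\<Sum>a<n. \<Sum>b<n. (\<Sum>k<m. S $$ (i, k) * (q k a b + q k b a)) *
      T $$ (a, j) * T $$ (b, d)) * Var d)"
proof -
  have "(\<Sum>k<m. S $$ (i, k) * (\<Sum>a<n. \<Sum>b<n. q k a b * T $$ (a, j) * T $$ (b, d))) +
      (\<Sum>k<m. S $$ (i, k) * (\<Sum>a<n. \<Sum>b<n. q k a b * T $$ (a, d) * T $$ (b, j))) =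
      (\<Sum>a<n. \<Sum>b<n. (\<Sum>k<m. S $$ (i, k) * (q k a b + q k b a)) * T $$ (a, j) * T $$ (b, d))" for d
  proof -
    have "(\<Sum>a<n. \<Sum>b<n. q k a b * T $$ (a, d) * T $$ (b, j)) =
        (\<Sum>a<n. \<Sum>b<n. q k b a * T $$ (a, j) * T $$ (b, d))" for k
      by (subst sum.swap) (simp add: ac_simps)
    then have "(\<Sum>k<m. S $$ (i, k) * (\<Sum>a<n. \<Sum>b<n. q k a b * T $$ (a, j) * T $$ (b, d))) +
      (\<Sum>k<m. S $$ (i, k) * (\<Sum>a<n. \<Sum>b<n. q k a b * T $$ (a, d) * T $$ (b, j))) =
      (\<Sum>k<m. \<Sum>a<n. \<Sum>b<n. S $$ (i, k) * (q k a b + q k b a) * T $$ (a, j) * T $$ (b, d))"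
      by (simp add: sum_distrib_left sum.distrib distrib_left distrib_right mult.assoc)
    also have "\<dots> = (\<Sum>a<n. \<Sum>b<n. \<Sum>k<m. S $$ (i, k) * (q k a b + q k b a) * T $$ (a, j) * T $$ (b, d))"
      by (rule trans[OF sum.swap], rule sum.cong[OF refl]) (rule sum.swap)
    finally show ?thesis by (simp add: sum_distrib_right)
  qed
  then show ?thesis
    using ij S
    by (simp add: jacobian_def linear_transform_quadratic_form[OF S T H q]
        pderiv_var_quadratic_form)
qed

section \<open>Rank and change of the base field\<close>

text \<open>Families are used instead of sets because the vectors may repeat; a repetition gives the
  coefficients 1 and -1.\<close>

lemma (in vector_space) dependent_family:
  assumes F: "finite F" "card F \<le> N" and u: "\<And>i. i \<le> N \<Longrightarrow> u i \<in> span F"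
  shows "\<exists>l. (\<exists>i\<le>N. l i \<noteq> 0) \<and> (\<Sum>i\<le>N. scale (l i) (u i)) = 0"
proof (cases "inj_on u {..N}")
  case True
  have "\<not> card (u ` {..N}) \<le> card F" using card_image[OF True] F(2) by simp
  then have "dependent (u ` {..N})"
    using independent_span_bound[OF F(1), of "u ` {..N}"] u by auto
  then obtain c where c: "\<exists>v \<in> u ` {..N}. c v \<noteq> 0" "(\<Sum>v \<in> u ` {..N}. scale (c v) v) = 0"
    by (subst (asm) dependent_finite) auto
  then show ?thesis
    by (intro exI[of _ "\<lambda>i. c (u i)"]) (auto simp: sum.reindex[OF True] o_def)
next
  case False
  then obtain i j where ij: "i \<le> N" "j \<le> N" "i \<noteq> j" "u i = u j" by (auto simp: inj_on_def)
  define l where "l k = (if k = i then 1 else if k = j then - 1 else 0 :: 'a)" for k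
  have "(\<Sum>k\<le>N. scale (l k) (u k)) = (\<Sum>k \<in> {i, j}. scale (l k) (u k))"
    by (rule sum.mono_neutral_right) (use ij in \<open>auto simp: l_def\<close>)
  then have "(\<Sum>k\<le>N. scale (l k) (u k)) = 0" using ij by (simp add: l_def)
  moreover have "l i \<noteq> 0" by (simp add: l_def)
  ultimately show ?thesis using ij(1) by blast
qed

text \<open>Functions on all of \<open>nat\<close> let arguments and values of the form, of n and m
  coordinates, share one type that is a \<open>vector_space\<close>. Vectors of matrices are
  embedded by \<open>vec_fun\<close>, padded with zeros.\<close>

definition fun_scale :: "'a::field \<Rightarrow> (nat \<Rightarrow> 'a) \<Rightarrow> nat \<Rightarrow> 'a" where
  "fun_scale c f = (\<lambda>i. c * f i)"

lemma fun_scale_apply [simp]: "fun_scale c f i = c * f i"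
  by (simp add: fun_scale_def)

interpretation fun_space: vector_space fun_scale
  by unfold_locales (auto simp: fun_eq_iff algebra_simps)

lemma sum_fun_apply: "(\<Sum>x \<in> A. f x) i = (\<Sum>x \<in> A. f x i)"
  for f :: "'b \<Rightarrow> 'c \<Rightarrow> 'a::comm_monoid_add"
  by (induction A rule: infinite_finite_induct) auto

definition vec_fun :: "'a::zero vec \<Rightarrow> nat \<Rightarrow> 'a" where
  "vec_fun x = (\<lambda>i. if i < dim_vec x then x $ i else 0)"

lemma inj_on_vec_fun: "inj_on vec_fun (carrier_vec n)"
proof (rule inj_onI)
  fix x y :: "'a vec" assume "x \<in> carrier_vec n" "y \<in> carrier_vec n" "vec_fun x = vec_fun y"
  then show "x = y"
    by (intro eq_vecI) (auto simp: vec_fun_def fun_eq_iff, metis)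
qed

lemma (in vec_space) lin_dep_iff_dependent_vec_fun:
  assumes S: "S \<subseteq> carrier_vec n"
  shows "lin_dep S \<longleftrightarrow> fun_space.dependent (vec_fun ` S)"
proof -
  have lincomb: "(lincomb a A = 0\<^sub>v n) \<longleftrightarrow> (\<Sum>x \<in> A. fun_scale (a x) (vec_fun x)) = 0"
    if A: "A \<subseteq> carrier_vec n" and finA: "finite A" for a A
  proof -
    have "(lincomb a A = 0\<^sub>v n) \<longleftrightarrow> (\<forall>i<n. (\<Sum>x \<in> A. a x * x $ i) = 0)"
      using lincomb_dim[OF finA A, of a] lincomb_index[OF _ A, of _ a] by (auto simp: vec_eq_iff)
    also have "\<dots> \<longleftrightarrow> (\<forall>i. (\<Sum>x \<in> A. a x * vec_fun x i) = 0)"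
    proof -
      have "(\<Sum>x \<in> A. a x * vec_fun x i) = (if i < n then \<Sum>x \<in> A. a x * x $ i else 0)" for i
        using A by (cases "i < n") (auto simp: vec_fun_def subset_iff intro!: sum.cong sum.neutral)
      then show ?thesis by simp
    qed
    finally show ?thesis by (simp add: fun_eq_iff sum_fun_apply)
  qed
  note inj = inj_on_subset[OF inj_on_vec_fun]
  show ?thesis
  proof
    assume "lin_dep S"
    then obtain A a v where A: "finite A" "A \<subseteq> S" "lincomb a A = 0\<^sub>v n" "v \<in> A" "a v \<noteq> 0"
      unfolding lin_dep_def by auto
    have inj: "inj_on vec_fun A" using inj A(2) S by blast
    have "(\<Sum>y \<in> vec_fun ` A. fun_scale (a (inv_into A vec_fun y)) y) =
        (\<Sum>x \<in> A. fun_scale (a x) (vec_fun x))"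
      by (simp add: sum.reindex[OF inj] inj)
    also have "\<dots> = 0" using A S lincomb[of A a] by auto
    finally show "fun_space.dependent (vec_fun ` S)"
      unfolding fun_space.dependent_explicit
      using A inj by (intro exI[of _ "vec_fun ` A"] exI[of _ "\<lambda>y. a (inv_into A vec_fun y)"]) auto
  next
    assume "fun_space.dependent (vec_fun ` S)"
    then obtain t u v where t: "finite t" "t \<subseteq> vec_fun ` S" "v \<in> t" "u v \<noteq> 0"
      "(\<Sum>y \<in> t. fun_scale (u y) y) = 0"
      unfolding fun_space.dependent_explicit by blast
    obtain A where A: "A \<subseteq> S" "finite A" "t = vec_fun ` A"
      using finite_subset_image[OF t(1,2)] by blast
    have inj: "inj_on vec_fun A" using inj A(1) S by blast
    have "(\<Sum>x \<in> A. fun_scale (u (vec_fun x)) (vec_fun x)) = 0"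
      using t(5) unfolding A(3) by (simp add: sum.reindex[OF inj])
    then have "lincomb (\<lambda>x. u (vec_fun x)) A = 0\<^sub>v n" using lincomb[of A] A S by auto
    moreover obtain x where "x \<in> A" "v = vec_fun x" using t(3) A(3) by blast
    ultimately show "lin_dep S"
      unfolding lin_dep_def using A(1,2) t(4)
      by (intro exI[of _ A] exI[of _ "\<lambda>x. u (vec_fun x)"] exI[of _ x]) auto
  qed
qed

text \<open>A maximal independent set of columns has \<open>rank A\<close> elements. Its image under
  \<open>vec_fun\<close> is independent and, by maximality, spans the images of all columns.\<close>

lemma (in vec_space) rank_eq_dim:
  assumes A: "A \<in> carrier_mat n nc"
  shows "rank A = fun_space.dim (vec_fun ` set (cols A))"
proof -
  have C: "set (cols A) \<subseteq> carrier_vec n" using cols_dim A by blast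
  obtain S where S: "finite S" "maximal S (\<lambda>T. T \<subseteq> set (cols A) \<and> lin_indpt T)"
    using maximal_exists_superset[of "set (cols A)" "\<lambda>T. T \<subseteq> set (cols A) \<and> lin_indpt T" "{}"]
    by (metis (no_types, lifting) List.finite_set empty_iff empty_subsetI finite.emptyI finite_lin_indpt2)
  then have sub: "S \<subseteq> set (cols A)" and ind: "lin_indpt S" by (auto simp: maximal_def)
  have ind': "fun_space.independent (vec_fun ` S)"
    using ind lin_dep_iff_dependent_vec_fun[of S] sub C by auto
  have "vec_fun x \<in> fun_space.span (vec_fun ` S)" if x: "x \<in> set (cols A)" for x
  proof (rule ccontr)
    assume n: "vec_fun x \<notin> fun_space.span (vec_fun ` S)"
    then have "fun_space.independent (vec_fun ` insert x S)"
      using fun_space.independent_insertI[OF n ind'] by simp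
    then have "lin_indpt (insert x S)"
      using lin_dep_iff_dependent_vec_fun[of "insert x S"] sub C x by auto
    then have "insert x S = S" using S(2) sub x unfolding maximal_def by blast
    then have "vec_fun x \<in> vec_fun ` S" by blast
    then show False using n fun_space.span_base by blast
  qed
  then have "vec_fun ` set (cols A) \<subseteq> fun_space.span (vec_fun ` S)" by blast
  then have "fun_space.dim (vec_fun ` set (cols A)) = card (vec_fun ` S)"
    using fun_space.basis_card_eq_dim[OF image_mono[OF sub] _ ind'] by simp
  also have "\<dots> = card S"
    by (rule card_image) (use inj_on_subset[OF inj_on_vec_fun] sub C in blast)
  finally show ?thesis using rank_card_indpt[OF A S(2)] by simp
qed

section \<open>Invertible matrices over the base field\<close>

lemma GL_I:
  assumes "P \<in> carrier_mat m m" "Q \<in> carrier_mat m m" "P * Q = 1\<^sub>m m" "Q * P = 1\<^sub>m m"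
  shows "P \<in> GL m"
  using assms by (auto simp: GL_def invertible_mat_def inverts_mat_def)

lemma GL_transpose:
  fixes P :: "'k::comm_ring_1 mat"
  assumes "P \<in> GL m" shows "transpose_mat P \<in> GL m"
proof -
  from assms obtain Q where P: "P \<in> carrier_mat m m" and Q: "P * Q = 1\<^sub>m m" "Q * P = 1\<^sub>m (dim_row Q)"
    by (auto simp: GL_def invertible_mat_def inverts_mat_def)
  have "dim_col Q = m" using arg_cong[OF Q(1), of dim_col] by simp
  moreover have r: "dim_row Q = m" using arg_cong[OF Q(2), of dim_col] P by simp
  ultimately have Qc: "Q \<in> carrier_mat m m" by auto
  have "transpose_mat P * transpose_mat Q = 1\<^sub>m m"
    unfolding transpose_mult[OF Qc P, symmetric] using Q(2) r by simp
  moreover have "transpose_mat Q * transpose_mat P = 1\<^sub>m m"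
    unfolding transpose_mult[OF P Qc, symmetric] using Q(1) by simp
  ultimately show ?thesis using P Qc by (intro GL_I[of _ _ "transpose_mat Q"]) auto
qed

text \<open>
  Either the vectors \<open>g t\<close> can be moved into the span of the first \<open>N\<close> unit vectors, or
  \<open>N + 1\<close> of them admit a dual family. The second alternative is preserved by field extensions,
  so it can be refuted over an extension field.
\<close>

lemma GL_or_dual_family:
  fixes g :: "nat \<Rightarrow> nat \<Rightarrow> 'k::field"
  shows "(\<exists>P \<in> GL m. \<forall>t<p. \<forall>i<m. N \<le> i \<longrightarrow> (\<Sum>k<m. P $$ (i, k) * g t k) = 0) \<or>
    (\<exists>\<tau> Y. \<forall>i\<le>N. \<tau> i < p \<and> (\<forall>j\<le>N. (\<Sum>k<m. Y j k * g (\<tau> i) k) = (if i = j then 1 else 0)))"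
proof -
  define A where "A = mat m p (\<lambda>(k, t). g t k)"
  have A: "A \<in> carrier_mat m p" by (simp add: A_def)
  define C where "C = gauss_jordan_single A"
  note gj = gauss_jordan_single[OF A C_def[symmetric]]
  obtain P Q where PQ: "C = P * A" "P \<in> carrier_mat m m" "Q \<in> carrier_mat m m"
    "P * Q = 1\<^sub>m m" "Q * P = 1\<^sub>m m"
    using gj(4) by blast
  have C: "C $$ (i, t) = (\<Sum>k<m. P $$ (i, k) * g t k)" if "i < m" "t < p" for i t
    using that PQ(1,2) by (simp add: A_def scalar_prod_def atLeast0LessThan)
  have dC: "dim_row C = m" "dim_col C = p" using gj(2) by auto
  obtain f where f: "pivot_fun C f p" using gj(3) dC by (auto simp: row_echelon_form_def)
  note pf = pivot_funD[OF dC(1) f]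
  show ?thesis
  proof (cases "N < m \<and> f N < p")
    case False
    have "(\<Sum>k<m. P $$ (i, k) * g t k) = 0" if t: "t < p" and i: "i < m" "N \<le> i" for t i
    proof -
      \<comment> \<open>The value \<open>p\<close> of the pivot function marks a zero row, and every
        row below a zero row is zero too.\<close>
      have "f i = p"
        using i(2) i(1)
      proof (induction i rule: dec_induct)
        case base
        then show ?case using False pf(1)[of N] by auto
      next
        case (step i)
        then show ?case using pf(1)[of "Suc i"] pf(3)[of i] by auto
      qed
      then show ?thesis using C[OF i(1) t] pf(2)[OF i(1), of t] t by simp
    qed
    then show ?thesis using GL_I[OF PQ(2-5)] by blast
  next
    case True
    have fi: "f i < p" if "i \<le> N" for i
      using that
    proof (induction i rule: inc_induct)
      case (step i)
      then show ?case using True pf(3)[of i] by auto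
    qed (use True in simp)
    \<comment> \<open>In reduced echelon form the pivot columns of \<open>C = P * A\<close> are unit
      vectors, so the rows of \<open>P\<close> are dual to the pivot columns of
      \<open>A\<close>.\<close>
    have "(\<Sum>k<m. P $$ (j, k) * g (f i) k) = (if i = j then 1 else 0)" if "i \<le> N" "j \<le> N" for i j
    proof -
      have "i < m" "j < m" using that True by auto
      then show ?thesis
        using C[OF _ fi[OF that(1)], of j] pf(4)[of i] pf(5)[of i j] fi[OF that(1)] by auto
    qed
    then show ?thesis
      using fi by (intro disjI2 exI[of _ f] exI[of _ "\<lambda>j k. P $$ (j, k)"]) auto
  qed
qed

section \<open>The polarization over the function field\<close>

definition to_frac :: "'a::idom \<Rightarrow> 'a fract" where
  "to_frac p = Fract p 1"

lemma to_frac_inj [simp]: "to_frac p = to_frac q \<longleftrightarrow> p = q"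
  by (simp add: to_frac_def eq_fract)

lemma comm_ring_hom_to_frac: "comm_ring_hom to_frac"
  by unfold_locales (simp_all add: to_frac_def Zero_fract_def One_fract_def)

lemma comm_ring_hom_compose:
  assumes "comm_ring_hom f" "comm_ring_hom g"
  shows "comm_ring_hom (\<lambda>x. f (g x))"
proof -
  interpret f: comm_ring_hom f by fact
  interpret g: comm_ring_hom g by fact
  show ?thesis by unfold_locales (simp_all add: f.hom_add g.hom_add f.hom_mult g.hom_mult)
qed

lemma comm_ring_hom_pCons: "comm_ring_hom (\<lambda>c. [:c:])"
  by unfold_locales (simp_all add: one_pCons)

lemma comm_ring_hom_poly: "comm_ring_hom (\<lambda>p. poly p x)" for x :: "'a::comm_ring_1"
  by unfold_locales simp_all

text \<open>Only the coordinates below \<open>n\<close> are covered: infinitely many fractions may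
  have no common denominator.\<close>

lemma common_denominator:
  fixes w :: "nat \<Rightarrow> 'a::idom fract"
  shows "\<exists>d p. d \<noteq> 0 \<and> (\<forall>c<n. to_frac d * w c = to_frac (p c))"
proof (induction n)
  case (Suc n)
  interpret to_frac: comm_ring_hom "to_frac :: 'a \<Rightarrow> 'a fract" by (rule comm_ring_hom_to_frac)
  from Suc obtain d p where d: "d \<noteq> 0" "\<And>c. c < n \<Longrightarrow> to_frac d * w c = to_frac (p c)" by blast
  obtain x y where xy: "w n = Fract x y" "y \<noteq> 0" by (cases "w n") auto
  have "to_frac (d * y) * w c = to_frac (if c = n then d * x else y * p c)" if "c < Suc n" for c
  proof (cases "c = n")
    case True
    then show ?thesis using xy by (simp add: to_frac_def eq_fract)
  next
    case False
    have "to_frac (d * y) * w c = to_frac y * (to_frac d * w c)"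
      by (simp add: to_frac.hom_mult ac_simps)
    also have "\<dots> = to_frac (y * p c)" using d(2)[of c] False that by (simp add: to_frac.hom_mult)
    finally show ?thesis using False by simp
  qed
  then show ?case using d(1) xy(2)
    by (intro exI[of _ "d * y"] exI[of _ "\<lambda>c. if c = n then d * x else y * p c"]) auto
qed (auto intro: exI[of _ 1])

lemma two_eq_0_iff_CHAR: "(2 :: 'k::field) = 0 \<longleftrightarrow> CHAR('k) = 2"
proof -
  have "(2 :: 'k) = 0 \<longleftrightarrow> CHAR('k) dvd 2"
    using of_nat_eq_0_iff_char_dvd[where ?'a = 'k, of 2] by simp
  also have "\<dots> \<longleftrightarrow> CHAR('k) = 2"
  proof
    assume *: "CHAR('k) dvd 2"
    then have "CHAR('k) \<le> 2" by (rule dvd_imp_le) simp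
    moreover have "CHAR('k) \<noteq> 0" using * by (cases "CHAR('k) = 0") simp_all
    moreover have "CHAR('k) \<noteq> 1" by simp
    ultimately show "CHAR('k) = 2" by linarith
  qed simp
  finally show ?thesis .
qed

definition unit_fun :: "nat \<Rightarrow> nat \<Rightarrow> 'a::zero_neq_one" where
  "unit_fun c = (\<lambda>i. if i = c then 1 else 0)"

locale quadratic_map =
  fixes m n :: nat and q :: "nat \<Rightarrow> nat \<Rightarrow> nat \<Rightarrow> 'k::field"
begin

text \<open>The polar form without a factor 1/2. Its diagonal is twice that of \<open>q\<close>,
  which makes it alternating in characteristic 2.\<close>

definition b :: "nat \<Rightarrow> nat \<Rightarrow> nat \<Rightarrow> 'k" where
  "b k a c = q k a c + q k c a"

definition \<iota> :: "'k \<Rightarrow> 'k mpoly fract" where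
  "\<iota> c = to_frac (Const c)"

definition X :: "nat \<Rightarrow> 'k mpoly fract" where
  "X a = to_frac (Var a)"

text \<open>Coordinates of the arguments from \<open>n\<close> on are ignored, so vectors supported
  there lie in the radical.\<close>

definition B :: "(nat \<Rightarrow> 'k mpoly fract) \<Rightarrow> (nat \<Rightarrow> 'k mpoly fract) \<Rightarrow> nat \<Rightarrow> 'k mpoly fract" where
  "B y z k = (if k < m then \<Sum>a<n. \<Sum>c<n. \<iota> (b k a c) * y a * z c else 0)"

lemma b_sym: "b k a c = b k c a"
  by (simp add: b_def add.commute)

sublocale to_frac: comm_ring_hom "to_frac :: 'k mpoly \<Rightarrow> 'k mpoly fract"
  by (rule comm_ring_hom_to_frac)

sublocale \<iota>: comm_ring_hom \<iota>
  unfolding \<iota>_def[abs_def] by (rule comm_ring_hom_compose[OF comm_ring_hom_to_frac comm_ring_hom_Const])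

lemma \<iota>_eq_0_iff: "\<iota> c = 0 \<longleftrightarrow> c = 0"
proof -
  have "\<iota> c = \<iota> 0 \<longleftrightarrow> c = 0" unfolding \<iota>_def to_frac_inj Const_def
    by (metis lookup_single_eq)
  then show ?thesis by simp
qed

lemma two_eq_0_iff: "(2 :: 'k mpoly fract) = 0 \<longleftrightarrow> CHAR('k) = 2"
proof -
  have "\<iota> 2 = 2" using \<iota>.hom_add[of 1 1] by simp
  then show ?thesis using \<iota>_eq_0_iff[of 2] two_eq_0_iff_CHAR[where ?'k = 'k] by simp
qed

lemma X_nonzero: "X a \<noteq> 0"
proof -
  have "X a = to_frac 0 \<longleftrightarrow> False" unfolding X_def to_frac_inj Var_def
    by (metis lookup_single_eq lookup_zero zero_neq_one)
  then show ?thesis by simp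
qed

lemma B_linear: "Vector_Spaces.linear fun_scale fun_scale (B y)"
  by (rule Vector_Spaces.linear_iff[THEN iffD2], intro conjI allI)
    (auto simp: fun_space.vector_space_axioms fun_eq_iff B_def algebra_simps sum.distrib sum_distrib_left)

lemma B_sym: "B y z = B z y"
proof
  fix k
  have "(\<Sum>a<n. \<Sum>c<n. \<iota> (b k a c) * y a * z c) = (\<Sum>c<n. \<Sum>a<n. \<iota> (b k a c) * y a * z c)"
    by (rule sum.swap)
  also have "\<dots> = (\<Sum>c<n. \<Sum>a<n. \<iota> (b k c a) * z c * y a)"
    by (simp add: b_sym[of k] mult.assoc mult.commute mult.left_commute)
  finally show "B y z k = B z y k" by (simp add: B_def)
qed

lemma B_alt: assumes "(2 :: 'k mpoly fract) = 0" shows "B y y = 0"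
proof
  fix k
  have "(\<Sum>a<n. \<Sum>c<n. \<iota> (b k a c) * y a * y c) =
      (\<Sum>a<n. \<Sum>c<n. \<iota> (q k a c) * y a * y c) + (\<Sum>a<n. \<Sum>c<n. \<iota> (q k c a) * y a * y c)"
    by (simp add: b_def \<iota>.hom_add distrib_right sum.distrib)
  also have "(\<Sum>a<n. \<Sum>c<n. \<iota> (q k c a) * y a * y c) = (\<Sum>a<n. \<Sum>c<n. \<iota> (q k a c) * y a * y c)"
    by (subst sum.swap) (simp add: mult.assoc mult.commute mult.left_commute)
  also have "(\<Sum>a<n. \<Sum>c<n. \<iota> (q k a c) * y a * y c) + (\<Sum>a<n. \<Sum>c<n. \<iota> (q k a c) * y a * y c) =
      2 * (\<Sum>a<n. \<Sum>c<n. \<iota> (q k a c) * y a * y c)"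
    by (rule mult_2[symmetric])
  finally show "B y y k = 0 k" using assms by (simp add: B_def)
qed

lemma B_expand: "B y z = (\<Sum>c<n. fun_scale (z c) (B y (unit_fun c)))"
proof
  fix k
  have "B y (unit_fun c) k = (if k < m then \<Sum>a<n. \<iota> (b k a c) * y a else 0)" if "c < n" for c
    using that by (simp add: B_def unit_fun_def if_distrib[of "\<lambda>u. _ * u"] cong: if_cong)
  then have "(\<Sum>c<n. z c * B y (unit_fun c) k) =
      (if k < m then \<Sum>c<n. \<Sum>a<n. \<iota> (b k a c) * y a * z c else 0)"
    by (simp add: sum_distrib_left mult.commute)
  also have "\<dots> = B y z k" unfolding B_def by (subst sum.swap) (rule refl)
  finally show "B y z k = (\<Sum>c<n. fun_scale (z c) (B y (unit_fun c))) k"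
    by (simp add: sum_fun_apply)
qed

lemma range_B: "range (B X) \<subseteq> fun_space.span ((\<lambda>c. B X (unit_fun c)) ` {..<n})"
proof
  fix u assume "u \<in> range (B X)"
  then obtain z where "u = B X z" by blast
  then have "u = (\<Sum>c<n. fun_scale (z c) (B X (unit_fun c)))" by (rule trans[OF _ B_expand])
  then show "u \<in> fun_space.span ((\<lambda>c. B X (unit_fun c)) ` {..<n})"
    by (simp only:) (intro fun_space.span_sum fun_space.span_scale fun_space.span_base[OF imageI])
qed

text \<open>
  A polynomial vector \<open>w\<close> in the kernel of \<open>B X\<close> is expanded at the point \<open>X + t y\<close>, where the
  matrix becomes \<open>B X + t B y\<close>; the coefficients of the expansion form the chain.
\<close>

lemma chain:
  assumes w: "B X w = 0"
  shows "\<exists>w1 w2 w3. B X w1 = - B y w \<and> B X w2 = - B y w1 \<and> B X w3 = - B y w2"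
proof -
  obtain d p where d: "d \<noteq> 0" "\<And>c. c < n \<Longrightarrow> to_frac d * w c = to_frac (p c)"
    using common_denominator[of n w] by blast
  \<comment> \<open>This homomorphism sends \<open>Var a\<close> to X a + t * y a. As
    \<open>y\<close> has fractions as coordinates, the target is the polynomial ring in t over the
    function field.\<close>
  define \<Phi> where "\<Phi> = eval_mpoly (\<lambda>c. [:\<iota> c:]) (\<lambda>a. [:X a, y a:])"
  interpret C: comm_ring_hom "\<lambda>c. [:\<iota> c:]"
    by (rule comm_ring_hom_compose[OF comm_ring_hom_pCons \<iota>.comm_ring_hom_axioms])
  have \<Phi>_hom: "comm_ring_hom \<Phi>" unfolding \<Phi>_def by (rule C.comm_ring_hom_eval_mpoly)
  interpret \<Phi>: comm_ring_hom \<Phi> by (rule \<Phi>_hom)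
  have \<Phi>_Const: "\<Phi> (Const c) = [:\<iota> c:]" for c unfolding \<Phi>_def by (rule C.eval_mpoly_Const)
  have \<Phi>_Var: "\<Phi> (Var a) = [:X a, y a:]" for a unfolding \<Phi>_def by (rule C.eval_mpoly_Var)
  \<comment> \<open>At t = 0 one gets a homomorphism that agrees with \<open>to_frac\<close> on
    constants and indeterminates.\<close>
  have \<Phi>_0: "coeff (\<Phi> u) 0 = to_frac u" for u
  proof -
    have "poly (\<Phi> u) 0 = eval_mpoly (\<lambda>c. poly (\<Phi> (Const c)) 0) (\<lambda>i. poly (\<Phi> (Var i)) 0) u"
      by (rule comm_ring_hom_eq_eval_mpoly[OF comm_ring_hom_compose[OF comm_ring_hom_poly \<Phi>_hom]])
    also have "\<dots> = eval_mpoly (\<lambda>c. to_frac (Const c)) (\<lambda>i. to_frac (Var i)) u"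
      by (simp add: \<Phi>_Const \<Phi>_Var \<iota>_def X_def)
    also have "\<dots> = to_frac u"
      by (rule comm_ring_hom_eq_eval_mpoly[OF comm_ring_hom_to_frac, symmetric])
    finally show ?thesis by (simp add: poly_0_coeff_0)
  qed
  define W where "W i c = coeff (\<Phi> (p c)) i" for i c
  have step: "B X (W (Suc i)) = - B y (W i)" for i
  proof
    fix k
    show "B X (W (Suc i)) k = (- B y (W i)) k"
    proof (cases "k < m")
      case True
      \<comment> \<open>The relation is multiplied by the common denominator, since
        \<open>\<Phi>\<close> can only be applied to an identity between polynomials.\<close>
      have "to_frac (\<Sum>a<n. \<Sum>c<n. Const (b k a c) * Var a * p c) =
          (\<Sum>a<n. \<Sum>c<n. \<iota> (b k a c) * X a * (to_frac d * w c))"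
        by (simp add: to_frac.hom_sum to_frac.hom_mult \<iota>_def X_def d(2))
      also have "\<dots> = to_frac d * B X w k"
        using True by (simp add: B_def sum_distrib_left mult.left_commute)
      also have "\<dots> = to_frac 0" using w by simp
      finally have "(\<Sum>a<n. \<Sum>c<n. Const (b k a c) * Var a * p c) = 0" by (simp only: to_frac_inj)
      then have "\<Phi> (\<Sum>a<n. \<Sum>c<n. Const (b k a c) * Var a * p c) = 0" by simp
      then have "(\<Sum>a<n. \<Sum>c<n. [:\<iota> (b k a c):] * [:X a, y a:] * \<Phi> (p c)) = 0"
        by (simp only: \<Phi>.hom_sum \<Phi>.hom_mult \<Phi>_Const \<Phi>_Var)
      then have "coeff (\<Sum>a<n. \<Sum>c<n. [:\<iota> (b k a c):] * [:X a, y a:] * \<Phi> (p c)) (Suc i) = 0"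
        by simp
      \<comment> \<open>In the coefficient at exponent i + 1, the constant terms \<open>X a\<close>
        meet \<open>W (Suc i)\<close> and the linear terms \<open>y a\<close> meet
        \<open>W i\<close>.\<close>
      then have "(\<Sum>a<n. \<Sum>c<n. \<iota> (b k a c) * X a * W (Suc i) c + \<iota> (b k a c) * y a * W i c) = 0"
        by (simp add: coeff_sum W_def mult.commute[of "\<iota> _"])
      then show ?thesis
        using True by (simp add: B_def sum.distrib add_eq_0_iff2)
    qed (simp add: B_def)
  qed
  interpret vp: vector_space_pair fun_scale fun_scale ..
  let ?e = "inverse (to_frac d)"
  have e: "?e * to_frac d = 1" using d(1) to_frac_inj[of d 0] by simp
  have scale: "B x (fun_scale c z) = fun_scale c (B x z)" for x z c
    by (rule vp.linear_scale[OF B_linear])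
  \<comment> \<open>\<open>W 0\<close> is known to agree with the multiple of \<open>w\<close> only
    in the coordinates below \<open>n\<close>, which are all that \<open>B\<close> reads.\<close>
  have "B y (W 0) = B y (fun_scale (to_frac d) w)"
    by (rule trans[OF B_expand trans[OF _ B_expand[symmetric]]]) (simp add: W_def \<Phi>_0 d(2))
  then have "fun_scale ?e (B y (W 0)) = B y w"
    by (simp add: scale e)
  moreover have "B X (fun_scale ?e (W (Suc i))) = - fun_scale ?e (B y (W i))" for i
    by (simp add: scale step fun_eq_iff)
  ultimately have "B X (fun_scale ?e (W 1)) = - B y w \<and>
      B X (fun_scale ?e (W 2)) = - B y (fun_scale ?e (W 1)) \<and>
      B X (fun_scale ?e (W 3)) = - B y (fun_scale ?e (W 2))"
    unfolding scale[of y] by (simp add: numeral_2_eq_2 numeral_3_eq_3)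
  then show ?thesis by blast
qed

sublocale generic_symmetric_form fun_scale fun_scale B X
proof (intro generic_symmetric_form.intro generic_symmetric_form_axioms.intro)
  show "vector_space_pair (fun_scale :: 'k mpoly fract \<Rightarrow> _) fun_scale" ..
  show "\<exists>F. finite F \<and> range (B X) \<subseteq> fun_space.span F" using range_B by blast
qed (rule B_linear B_sym B_alt chain; assumption)+

section \<open>The rank of the Jacobian as the dimension of the value space\<close>

lemma r_le_card: "finite F \<Longrightarrow> range (B X) \<subseteq> fun_space.span F \<Longrightarrow> r \<le> card F"
  unfolding r_def by (rule fun_space.dim_le_card)

lemma r_eq_dim: "r = fun_space.dim ((\<lambda>c. B X (unit_fun c)) ` {..<n})"
proof -
  have "fun_space.span ((\<lambda>c. B X (unit_fun c)) ` {..<n}) = range (B X)"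
    by (rule fun_space.span_subspace[OF _ range_B subspace_U]) auto
  then show ?thesis unfolding r_def by (metis fun_space.dim_span)
qed

lemma B_unit_right:
  "c < n \<Longrightarrow> B y (unit_fun c) k = (if k < m then \<Sum>a<n. \<iota> (b k a c) * y a else 0)"
  by (simp add: B_def unit_fun_def if_distrib[of "\<lambda>u. _ * u"] cong: if_cong)

lemma to_frac_jacobian:
  assumes "H \<in> carrier_vec m" "\<And>k. k < m \<Longrightarrow> H $ k = quadratic_form n (q k)" "k < m" "c < n"
  shows "to_frac (jacobian n H $$ (k, c)) = B X (unit_fun c) k"
proof -
  have "jacobian n H $$ (k, c) = (\<Sum>a<n. Const (b k a c) * Var a)"
    using assms by (simp add: jacobian_def pderiv_var_quadratic_form b_def add.commute)
  then show ?thesis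
    using assms by (simp add: B_unit_right to_frac.hom_sum to_frac.hom_mult \<iota>_def X_def)
qed

lemma fract_rank_jacobian:
  assumes H: "H \<in> carrier_vec m" "\<And>k. k < m \<Longrightarrow> H $ k = quadratic_form n (q k)"
  shows "fract_rank (jacobian n H) = r"
proof -
  define A where "A = map_mat to_frac (jacobian n H)"
  have A: "A \<in> carrier_mat m n" using H(1) by (simp add: A_def jacobian_def)
  have "vec_fun (col A c) = B X (unit_fun c)" if c: "c < n" for c
  proof
    fix k
    show "vec_fun (col A c) k = B X (unit_fun c) k"
    proof (cases "k < m")
      case True
      then have "col A c $ k = to_frac (jacobian n H $$ (k, c))"
        using A c by (simp add: A_def)
      then show ?thesis using A True to_frac_jacobian[OF H True c] by (simp add: vec_fun_def)
    next
      case False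
      then show ?thesis using A c by (simp add: vec_fun_def B_unit_right)
    qed
  qed
  moreover have "set (cols A) = col A ` {..<n}" using A by (auto simp: cols_def)
  ultimately have "vec_fun ` set (cols A) = (\<lambda>c. B X (unit_fun c)) ` {..<n}"
    by (simp add: image_image)
  moreover have "fract_rank (jacobian n H) = vec_space.rank m A"
    using H(1) by (simp add: fract_rank_def A_def to_frac_def[abs_def] jacobian_def)
  ultimately show ?thesis using vec_space.rank_eq_dim[OF A] r_eq_dim by simp
qed

text \<open>If echelon reduction over the base field failed, a dual family \<open>Y\<close> would
  single out N + 1 values of the form at unit vectors. By \<open>rows_le\<close> these are dependent
  over the function field, but applying \<open>Y\<close> to a relation between them shows that its
  coefficients vanish.\<close>

lemma rows_descent:
  assumes "rows_le N"
  shows "\<exists>S \<in> GL m. \<forall>i<m. N \<le> i \<longrightarrow> (\<forall>a<n. \<forall>c<n. (\<Sum>k<m. S $$ (i, k) * b k a c) = 0)"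
proof -
  \<comment> \<open>The index \<open>t\<close> encodes the pair (a, c) as a * n + c.\<close>
  define g where "g t k = b k (t div n) (t mod n)" for t k
  have "\<not> (\<exists>\<tau> Y. \<forall>i\<le>N. \<tau> i < n * n \<and>
      (\<forall>j\<le>N. (\<Sum>k<m. Y j k * g (\<tau> i) k) = (if i = j then 1 else 0)))"
  proof
    assume "\<exists>\<tau> Y. \<forall>i\<le>N. \<tau> i < n * n \<and>
      (\<forall>j\<le>N. (\<Sum>k<m. Y j k * g (\<tau> i) k) = (if i = j then 1 else 0))"
    then obtain \<tau> Y where \<tau>: "\<And>i. i \<le> N \<Longrightarrow> \<tau> i < n * n"
      and Y: "\<And>i j. i \<le> N \<Longrightarrow> j \<le> N \<Longrightarrow> (\<Sum>k<m. Y j k * g (\<tau> i) k) = (if i = j then 1 else 0)"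
      by blast
    define u where "u i = B (unit_fun (\<tau> i div n)) (unit_fun (\<tau> i mod n))" for i
    have u: "u i k = \<iota> (g (\<tau> i) k)" if "i \<le> N" "k < m" for i k
    proof -
      have n: "0 < n" using \<tau>[OF that(1)] by (cases n) auto
      have "\<tau> i div n < n" using \<tau>[OF that(1)] by (rule less_mult_imp_div_less)
      moreover have "u i k = (\<Sum>a<n. \<iota> (b k a (\<tau> i mod n)) * unit_fun (\<tau> i div n) a)"
        using that(2) n by (simp add: u_def B_unit_right)
      ultimately show ?thesis
        by (simp add: g_def unit_fun_def if_distrib[of "\<lambda>u. _ * u"] cong: if_cong)
    qed
    obtain F where F: "finite F" "card F \<le> N" "\<And>y z. B y z \<in> fun_space.span F"
      using assms unfolding rows_le_def by blast
    obtain l i where i: "i \<le> N" "l i \<noteq> 0" "(\<Sum>j\<le>N. fun_scale (l j) (u j)) = 0"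
      using fun_space.dependent_family[OF F(1,2), of u] F(3) unfolding u_def by blast
    have z: "(\<Sum>j\<le>N. l j * u j k) = 0" for k
      using fun_cong[OF i(3), of k] by (simp add: sum_fun_apply)
    have "0 = (\<Sum>k<m. \<iota> (Y i k) * (\<Sum>j\<le>N. l j * u j k))" by (simp add: z)
    also have "\<dots> = (\<Sum>j\<le>N. \<Sum>k<m. \<iota> (Y i k) * (l j * u j k))"
      unfolding sum_distrib_left by (rule sum.swap)
    also have "\<dots> = (\<Sum>j\<le>N. l j * \<iota> (\<Sum>k<m. Y i k * g (\<tau> j) k))"
      by (intro sum.cong refl)
        (simp add: u \<iota>.hom_sum \<iota>.hom_mult sum_distrib_left mult.left_commute)
    also have "\<dots> = (\<Sum>j\<le>N. if j = i then l j else 0)"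
      using Y i(1) by (intro sum.cong refl) auto
    also have "\<dots> = l i" using i(1) by simp
    finally show False using i(2) by simp
  qed
  then obtain P where P: "P \<in> GL m"
    "\<And>t i. t < n * n \<Longrightarrow> i < m \<Longrightarrow> N \<le> i \<Longrightarrow> (\<Sum>k<m. P $$ (i, k) * g t k) = 0"
    using GL_or_dual_family[of m "n * n" N g] by blast
  have "(\<Sum>k<m. P $$ (i, k) * b k a c) = 0" if i: "i < m" "N \<le> i" and ac: "a < n" "c < n" for i a c
  proof -
    have "a * n + c < n * n"
    proof -
      have "Suc a * n \<le> n * n" using ac by (intro mult_le_mono1) simp
      then show ?thesis using ac by simp
    qed
    from P(2)[OF this i] show ?thesis using ac by (simp add: g_def)
  qed
  then show ?thesis using P(1) by blast
qed

text \<open>Here the \<open>g t\<close> are linear functionals of the argument, obtained by fixing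
  the other argument at a unit vector and choosing a component; together they cut out the radical. A
  dual family would give N + 1 vectors that stay independent modulo \<open>rad\<close> over the
  function field, because the functionals read off the coefficients of any combination.\<close>

lemma cols_descent:
  assumes "cols_le N"
  shows "\<exists>T \<in> GL n. \<forall>j<n. N \<le> j \<longrightarrow> (\<forall>k<m. \<forall>c<n. (\<Sum>a<n. b k a c * T $$ (a, j)) = 0)"
proof -
  define g where "g t a = b (t div n) a (t mod n)" for t a
  have "\<not> (\<exists>\<tau> Y. \<forall>i\<le>N. \<tau> i < m * n \<and>
      (\<forall>j\<le>N. (\<Sum>a<n. Y j a * g (\<tau> i) a) = (if i = j then 1 else 0)))"
  proof
    assume "\<exists>\<tau> Y. \<forall>i\<le>N. \<tau> i < m * n \<and>
      (\<forall>j\<le>N. (\<Sum>a<n. Y j a * g (\<tau> i) a) = (if i = j then 1 else 0))"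
    then obtain \<tau> Y where \<tau>: "\<And>i. i \<le> N \<Longrightarrow> \<tau> i < m * n"
      and Y: "\<And>i j. i \<le> N \<Longrightarrow> j \<le> N \<Longrightarrow> (\<Sum>a<n. Y j a * g (\<tau> i) a) = (if i = j then 1 else 0)"
      by blast
    define y where "y j a = \<iota> (Y j a)" for j a
    obtain G where G: "finite G" "card G \<le> N" "\<And>x. \<exists>u \<in> fun_space.span G. x - u \<in> rad"
      using assms unfolding cols_le_def by blast
    have "\<forall>j. \<exists>u. u \<in> fun_space.span G \<and> y j - u \<in> rad" using G(3) by blast
    from choice[OF this] obtain u where u: "\<And>j. u j \<in> fun_space.span G" "\<And>j. y j - u j \<in> rad"
      by blast
    obtain l i where i: "i \<le> N" "l i \<noteq> 0" "(\<Sum>j\<le>N. fun_scale (l j) (u j)) = 0"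
      using fun_space.dependent_family[OF G(1,2), of u] u(1) by blast
    define w where "w = (\<Sum>j\<le>N. fun_scale (l j) (y j))"
    have "w = (\<Sum>j\<le>N. fun_scale (l j) (y j - u j))"
      using i(3) by (simp add: w_def fun_space.scale_right_diff_distrib sum_subtractf)
    then have "w \<in> rad"
      using u(2) by (simp add: fun_space.subspace_sum[OF subspace_rad] fun_space.subspace_scale[OF subspace_rad])
    define k where "k = \<tau> i div n"
    define c where "c = \<tau> i mod n"
    have "0 < n" using \<tau>[OF i(1)] by (cases n) auto
    then have c: "c < n" by (simp add: c_def)
    have k: "k < m" unfolding k_def using \<tau>[OF i(1)] by (rule less_mult_imp_div_less)
    have "0 = B w (unit_fun c) k" using \<open>w \<in> rad\<close> by (simp add: rad_def B_sym[of w])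
    also have "\<dots> = (\<Sum>a<n. \<iota> (b k a c) * w a)" using c k by (simp add: B_unit_right)
    also have "\<dots> = (\<Sum>a<n. \<Sum>j\<le>N. \<iota> (b k a c) * (l j * y j a))"
      by (simp add: w_def sum_fun_apply sum_distrib_left)
    also have "\<dots> = (\<Sum>j\<le>N. \<Sum>a<n. \<iota> (b k a c) * (l j * y j a))" by (rule sum.swap)
    also have "\<dots> = (\<Sum>j\<le>N. l j * \<iota> (\<Sum>a<n. Y j a * g (\<tau> i) a))"
      by (simp add: y_def g_def k_def c_def \<iota>.hom_sum \<iota>.hom_mult sum_distrib_left ac_simps)
    also have "\<dots> = (\<Sum>j\<le>N. if j = i then l j else 0)"
      using Y i(1) by (intro sum.cong refl) auto
    also have "\<dots> = l i" using i(1) by simp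
    finally show False using i(2) by simp
  qed
  then obtain P where P: "P \<in> GL n"
    "\<And>t j. t < m * n \<Longrightarrow> j < n \<Longrightarrow> N \<le> j \<Longrightarrow> (\<Sum>a<n. P $$ (j, a) * g t a) = 0"
    using GL_or_dual_family[of n "m * n" N g] by blast
  \<comment> \<open>The rows of \<open>P\<close> from \<open>N\<close> on are radical vectors, and
    transposition turns them into columns of \<open>T\<close>.\<close>
  have "(\<Sum>a<n. b k a c * transpose_mat P $$ (a, j)) = 0"
    if j: "j < n" "N \<le> j" and kc: "k < m" "c < n" for j k c
  proof -
    have "k * n + c < m * n"
    proof -
      have "Suc k * n \<le> m * n" using kc by (intro mult_le_mono1) simp
      then show ?thesis using kc by simp
    qed
    from P(2)[OF this j] have "(\<Sum>a<n. b k a c * P $$ (j, a)) = 0"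
      using kc by (simp add: g_def mult.commute)
    moreover have "transpose_mat P $$ (a, j) = P $$ (j, a)" if "a < n" for a
      using P(1) j that by (auto simp: GL_def)
    ultimately show ?thesis by simp
  qed
  then show ?thesis using GL_transpose[OF P(1)] by blast
qed

section \<open>Rank bounds from the shape of the Jacobian\<close>

lemma r_le_of_first_cols:
  assumes "\<And>c. c < n \<Longrightarrow> N \<le> c \<Longrightarrow> B X (unit_fun c) \<in> fun_space.span ((\<lambda>c. B X (unit_fun c)) ` {..<N})"
  shows "r \<le> N"
proof -
  let ?F = "(\<lambda>c. B X (unit_fun c)) ` {..<N}"
  have "(\<lambda>c. B X (unit_fun c)) ` {..<n} \<subseteq> fun_space.span ?F"
  proof
    fix u assume "u \<in> (\<lambda>c. B X (unit_fun c)) ` {..<n}"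
    then obtain c where "c < n" "u = B X (unit_fun c)" by blast
    then show "u \<in> fun_space.span ?F"
      using assms[of c] by (cases "c < N") (auto intro: fun_space.span_base)
  qed
  then have "fun_space.span ((\<lambda>c. B X (unit_fun c)) ` {..<n}) \<subseteq> fun_space.span ?F"
    by (intro fun_space.span_minimal fun_space.subspace_span)
  with range_B have "range (B X) \<subseteq> fun_space.span ?F" by (rule order_trans)
  then have "r \<le> card ?F" by (intro r_le_card) simp
  also have "\<dots> \<le> N" using card_image_le[of "{..<N}"] by simp
  finally show ?thesis .
qed

text \<open>The extra column adds nothing to the rank: \<open>B X X = 0\<close> is a linear relation
  between the columns in which column \<open>N\<close> has the nonzero coefficient
  \<open>X N\<close>.\<close>

lemma r_le_char_2:
  assumes 2: "(2 :: 'k mpoly fract) = 0" and N: "\<And>c. c < n \<Longrightarrow> N + 1 \<le> c \<Longrightarrow> B X (unit_fun c) = 0"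
  shows "r \<le> N"
proof (rule r_le_of_first_cols)
  let ?F = "(\<lambda>c. B X (unit_fun c)) ` {..<N}"
  fix c assume c: "c < n" "N \<le> c"
  show "B X (unit_fun c) \<in> fun_space.span ?F"
  proof (cases "c = N")
    case True
    have "0 = (\<Sum>j<n. fun_scale (X j) (B X (unit_fun j)))"
      using B_alt[OF 2, of X] B_expand[of X X] by simp
    also have "\<dots> = (\<Sum>j<Suc N. fun_scale (X j) (B X (unit_fun j)))"
      by (rule sum.mono_neutral_right) (use c True N in auto)
    also have "\<dots> = (\<Sum>j<N. fun_scale (X j) (B X (unit_fun j))) + fun_scale (X N) (B X (unit_fun N))"
      by simp
    finally have "fun_scale (X N) (B X (unit_fun N)) = - (\<Sum>j<N. fun_scale (X j) (B X (unit_fun j)))"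
      by (rule iffD1[OF add_eq_0_iff, OF sym])
    also have "\<dots> \<in> fun_space.span ?F"
      by (intro fun_space.span_neg fun_space.span_sum fun_space.span_scale fun_space.span_base[OF imageI])
    finally have "fun_scale (inverse (X N)) (fun_scale (X N) (B X (unit_fun N))) \<in> fun_space.span ?F"
      by (rule fun_space.span_scale)
    then show ?thesis using X_nonzero[of N] True by simp
  next
    case False
    then show ?thesis using N[OF c(1)] c(2) fun_space.span_zero by simp
  qed
qed

lemma r_le_of_first_rows:
  assumes "\<And>z k. N \<le> k \<Longrightarrow> B X z k = 0"
  shows "r \<le> N"
proof -
  let ?F = "unit_fun ` {..<N} :: (nat \<Rightarrow> 'k mpoly fract) set"
  have "B X z \<in> fun_space.span ?F" for z
  proof -
    have "B X z = (\<Sum>k<N. fun_scale (B X z k) (unit_fun k))"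
      using assms by (auto simp: fun_eq_iff sum_fun_apply unit_fun_def if_distrib[of "\<lambda>u. _ * u"] cong: if_cong)
    also have "\<dots> \<in> fun_space.span ?F"
      by (intro fun_space.span_sum fun_space.span_scale fun_space.span_base[OF imageI])
    finally show ?thesis .
  qed
  then have "r \<le> card ?F" by (intro r_le_card) auto
  also have "\<dots> \<le> N" using card_image_le[of "{..<N}"] by simp
  finally show ?thesis .
qed

text \<open>\<open>S\<close> combines the values of the form and \<open>T\<close> its arguments. A
  combination that kills all values does so for every \<open>T\<close>; dually, columns of
  \<open>T\<close> in the radical give zero columns for every \<open>S\<close>.\<close>

lemma first_rows_linear_transform:
  assumes S: "S \<in> GL m" and T: "T \<in> GL n"
    and H: "H \<in> carrier_vec m" "\<And>k. k < m \<Longrightarrow> H $ k = quadratic_form n (q k)"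
    and zero: "\<And>i a c. i < m \<Longrightarrow> N \<le> i \<Longrightarrow> a < n \<Longrightarrow> c < n \<Longrightarrow> (\<Sum>k<m. S $$ (i, k) * b k a c) = 0"
  shows "only_first_rows N (jacobian n (linear_transform S T H))"
proof -
  have ST: "S \<in> carrier_mat m m" "T \<in> carrier_mat n n" using S T by (auto simp: GL_def)
  have "jacobian n (linear_transform S T H) $$ (i, j) = 0" if "i < m" "N \<le> i" "j < n" for i j
    using that zero by (simp add: jacobian_linear_transform[OF ST H] b_def[symmetric])
  then show ?thesis
    using ST(1) by (auto simp: only_first_rows_def jacobian_def)
qed

lemma first_cols_linear_transform:
  assumes S: "S \<in> GL m" and T: "T \<in> GL n"
    and H: "H \<in> carrier_vec m" "\<And>k. k < m \<Longrightarrow> H $ k = quadratic_form n (q k)"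
    and zero: "\<And>j k c. j < n \<Longrightarrow> N \<le> j \<Longrightarrow> k < m \<Longrightarrow> c < n \<Longrightarrow> (\<Sum>a<n. b k a c * T $$ (a, j)) = 0"
  shows "only_first_cols N (jacobian n (linear_transform S T H))"
proof -
  have ST: "S \<in> carrier_mat m m" "T \<in> carrier_mat n n" using S T by (auto simp: GL_def)
  have "jacobian n (linear_transform S T H) $$ (i, j) = 0" if ij: "i < m" "j < n" "N \<le> j" for i j
  proof -
    have "(\<Sum>a<n. \<Sum>c<n. (\<Sum>k<m. S $$ (i, k) * (q k a c + q k c a)) * T $$ (a, j) * T $$ (c, d)) = 0" for d
    proof -
      have "(\<Sum>a<n. (\<Sum>k<m. S $$ (i, k) * b k a c) * T $$ (a, j)) = 0" if "c < n" for c
      proof -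
        have "(\<Sum>a<n. (\<Sum>k<m. S $$ (i, k) * b k a c) * T $$ (a, j)) =
            (\<Sum>k<m. S $$ (i, k) * (\<Sum>a<n. b k a c * T $$ (a, j)))"
          unfolding sum_distrib_left sum_distrib_right
          by (subst sum.swap) (simp add: mult.assoc)
        also have "\<dots> = 0" using zero ij(2,3) that by simp
        finally show ?thesis .
      qed
      then show ?thesis
        unfolding b_def[symmetric] by (subst sum.swap) (simp add: sum_distrib_right[symmetric])
    qed
    then show ?thesis using ij by (simp add: jacobian_linear_transform[OF ST H])
  qed
  then show ?thesis
    using ST(1) by (auto simp: only_first_cols_def jacobian_def)
qed

lemma normal_form:
  assumes H: "H \<in> carrier_vec m" "\<And>k. k < m \<Longrightarrow> H $ k = quadratic_form n (q k)"
  shows "\<exists>S \<in> GL m. \<exists>T \<in> GL n. let H' = linear_transform S T H in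
    only_first_rows ((r\<^sup>2 + r) div 2) (jacobian n H') \<and>
    (few_rows n r H' \<or> few_cols_char_not_2 n r H' \<or> few_cols_char_2 n r H')"
proof -
  let ?M = "(r\<^sup>2 + r) div 2" and ?N = "(r\<^sup>2 - r) div 2 + 1"
  have "rows_le ?M \<and> (rows_le ?N \<or> CHAR('k) \<noteq> 2 \<and> cols_le r \<or> CHAR('k) = 2 \<and> cols_le (r + 1))"
    using classification_char_2 classification_char_not_2 two_eq_0_iff by blast
  \<comment> \<open>Both row bounds must hold for the same \<open>S\<close>, so the smaller one is
    realized. It is \<open>?M\<close> for r = 0, and \<open>?N\<close> for r \<ge> 1.\<close>
  then consider "rows_le (min ?M ?N)"
    | N where "rows_le ?M" "cols_le N"
      "CHAR('k) \<noteq> 2 \<and> N = r \<or> CHAR('k) = 2 \<and> N = r + 1"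
    by (metis min_def)
  then show ?thesis
  proof cases
    case 1
    obtain S where S: "S \<in> GL m"
      "\<forall>i<m. min ?M ?N \<le> i \<longrightarrow> (\<forall>a<n. \<forall>c<n. (\<Sum>k<m. S $$ (i, k) * b k a c) = 0)"
      using rows_descent[OF 1] by blast
    have T: "1\<^sub>m n \<in> GL n" by (rule GL_I[of _ _ "1\<^sub>m n"]) auto
    have "only_first_rows N' (jacobian n (linear_transform S (1\<^sub>m n) H))" if "min ?M ?N \<le> N'" for N'
      by (rule first_rows_linear_transform[OF S(1) T H]) (use S(2) that in auto)
    from this[of ?M] this[of ?N] show ?thesis
      unfolding few_rows_def Let_def using S(1) T by (metis min.cobounded1 min.cobounded2)
  next
    case (2 N)
    obtain S where S: "S \<in> GL m"
      "\<forall>i<m. ?M \<le> i \<longrightarrow> (\<forall>a<n. \<forall>c<n. (\<Sum>k<m. S $$ (i, k) * b k a c) = 0)"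
      using rows_descent[OF 2(1)] by blast
    obtain T where T: "T \<in> GL n"
      "\<forall>j<n. N \<le> j \<longrightarrow> (\<forall>k<m. \<forall>c<n. (\<Sum>a<n. b k a c * T $$ (a, j)) = 0)"
      using cols_descent[OF 2(2)] by blast
    have "only_first_rows ?M (jacobian n (linear_transform S T H))"
      by (rule first_rows_linear_transform[OF S(1) T(1) H]) (use S(2) in auto)
    moreover have "only_first_cols N (jacobian n (linear_transform S T H))"
      by (rule first_cols_linear_transform[OF S(1) T(1) H]) (use T(2) in auto)
    ultimately show ?thesis
      unfolding few_cols_char_not_2_def few_cols_char_2_def Let_def using S(1) T(1) 2(3) by blast
  qed
qed

lemma rank_le:
  assumes H: "H \<in> carrier_vec m" "\<And>k. k < m \<Longrightarrow> H $ k = quadratic_form n (q k)"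
    and N: "few_cols_char_not_2 n N H \<or> few_cols_char_2 n N H \<or> (1 \<le> N \<and> N \<le> 2 \<and> few_rows n N H)"
  shows "r \<le> N"
proof -
  have entry: "B X (unit_fun c) k = 0" if "k < m \<Longrightarrow> jacobian n H $$ (k, c) = 0" "c < n" for k c
    using that to_frac_jacobian[OF H, of k c] by (cases "k < m") (auto simp: B_def)
  have dim: "dim_row (jacobian n H) = m" "dim_col (jacobian n H) = n"
    using H(1) by (auto simp: jacobian_def)
  have cols: "B X (unit_fun c) = 0" if "only_first_cols M (jacobian n H)" "c < n" "M \<le> c" for M c
  proof
    fix k
    have "jacobian n H $$ (k, c) = 0" if "k < m"
    proof -
      have "col (jacobian n H) c = 0\<^sub>v m"
        using \<open>only_first_cols M (jacobian n H)\<close> \<open>c < n\<close> \<open>M \<le> c\<close> dim by (auto simp: only_first_cols_def)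
      from arg_cong[OF this, of "\<lambda>x. x $ k"] show ?thesis using that \<open>c < n\<close> dim by simp
    qed
    then show "B X (unit_fun c) k = 0 k" using entry \<open>c < n\<close> by simp
  qed
  from N consider "only_first_cols N (jacobian n H)"
    | "CHAR('k) = 2" "only_first_cols (N + 1) (jacobian n H)"
    | "1 \<le> N" "N \<le> 2" "few_rows n N H"
    unfolding few_cols_char_not_2_def few_cols_char_2_def by blast
  then show ?thesis
  proof cases
    case 1
    show ?thesis by (rule r_le_of_first_cols) (simp add: cols[OF 1] fun_space.span_zero)
  next
    case 2
    then show ?thesis using two_eq_0_iff by (intro r_le_char_2 cols[OF 2(2)]) auto
  next
    case 3
    have "N = 1 \<or> N = 2" using 3 by auto
    then have rows: "only_first_rows N (jacobian n H)" using 3(3) by (auto simp: few_rows_def numeral_2_eq_2)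
    have "B X z k = 0" if "N \<le> k" for z k
    proof -
      have "B X (unit_fun c) k = 0" if c: "c < n" for c
      proof (rule entry[OF _ c])
        assume k: "k < m"
        have "row (jacobian n H) k = 0\<^sub>v n"
          using rows k \<open>N \<le> k\<close> dim by (auto simp: only_first_rows_def)
        from arg_cong[OF this, of "\<lambda>x. x $ c"] show "jacobian n H $$ (k, c) = 0"
          using k c dim by simp
      qed
      then show ?thesis using fun_cong[OF B_expand[of X z], of k] by (simp add: sum_fun_apply)
    qed
    then show ?thesis by (rule r_le_of_first_rows)
  qed
qed

end

lemma quadratic_homogeneous_eq_quadratic_form:
  fixes H :: "'k::comm_ring_1 mpoly vec"
  assumes "quadratic_homogeneous m n H"
  shows "\<exists>q. \<forall>k<m. H $ k = quadratic_form n (q k)"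
proof -
  have "\<forall>k. \<exists>q. k < m \<longrightarrow> H $ k = quadratic_form n q"
    using assms homogeneous_2_eq_quadratic_form unfolding quadratic_homogeneous_def by blast
  from choice[OF this] show ?thesis by blast
qed

theorem theorem2p1:
  fixes m n :: nat
  shows "(\<forall>H :: 'k::field mpoly vec. quadratic_homogeneous m n H \<longrightarrow>
            (let r = fract_rank (jacobian n H) in
             \<exists>S \<in> GL m. \<exists>T \<in> GL n.
               let H' = linear_transform S T H in
                 only_first_rows ((r\<^sup>2 + r) div 2) (jacobian n H') \<and>
                 (few_rows n r H' \<or> few_cols_char_not_2 n r H' \<or> few_cols_char_2 n r H')))
       \<and> (\<forall>(r :: nat) (H' :: 'k mpoly vec). quadratic_homogeneous m n H' \<longrightarrow>
            few_cols_char_not_2 n r H' \<or> few_cols_char_2 n r H'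
              \<or> (1 \<le> r \<and> r \<le> 2 \<and> few_rows n r H') \<longrightarrow>
            fract_rank (jacobian n H') \<le> r)"
proof (intro conjI allI impI)
  fix H :: "'k mpoly vec"
  assume quad: "quadratic_homogeneous m n H"
  obtain q where q: "\<forall>k<m. H $ k = quadratic_form n (q k)"
    using quadratic_homogeneous_eq_quadratic_form[OF quad] by blast
  have H: "H \<in> carrier_vec m" "\<And>k. k < m \<Longrightarrow> H $ k = quadratic_form n (q k)"
    using quad q by (auto simp: quadratic_homogeneous_def)
  show "let r = fract_rank (jacobian n H) in
      \<exists>S \<in> GL m. \<exists>T \<in> GL n.
        let H' = linear_transform S T H in
          only_first_rows ((r\<^sup>2 + r) div 2) (jacobian n H') \<and>
          (few_rows n r H' \<or> few_cols_char_not_2 n r H' \<or> few_cols_char_2 n r H')"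
    using quadratic_map.normal_form[OF H] by (simp add: quadratic_map.fract_rank_jacobian[OF H])
next
  fix r and H' :: "'k mpoly vec"
  assume quad: "quadratic_homogeneous m n H'"
    and N: "few_cols_char_not_2 n r H' \<or> few_cols_char_2 n r H' \<or> (1 \<le> r \<and> r \<le> 2 \<and> few_rows n r H')"
  obtain q where q: "\<forall>k<m. H' $ k = quadratic_form n (q k)"
    using quadratic_homogeneous_eq_quadratic_form[OF quad] by blast
  have H: "H' \<in> carrier_vec m" "\<And>k. k < m \<Longrightarrow> H' $ k = quadratic_form n (q k)"
    using quad q by (auto simp: quadratic_homogeneous_def)
  show "fract_rank (jacobian n H') \<le> r"
    using quadratic_map.rank_le[OF H N] by (simp add: quadratic_map.fract_rank_jacobian[OF H])
qed

end
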